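(* Let $k\geq 2$ be an integer and let $t$ be an integer with $1\leq t\leq \frac{(k-2)(k+1)}{2}-1$. Then every graph on $n\geq k-1$ vertices with at least $(k-1)n-t$ edges contains a subgraph on at most $$\left(1-\frac{1}{\max(10^{4}k^2,\ 100kt)}\right)n$$ vertices and with minimum degree at least $k$.
   Context: All graphs are finite and simple. Subgraphs are non-empty; a graph with minimum degree at least $k$ is in particular non-empty. *)

theory Defs
  imports Complex_Main
begin

text \<open>A graph is given by its vertex set and its set of edges; an edge is the set of its two ends.\<close>

definition simple_graph :: "'a set \<Rightarrow> 'a set set \<Rightarrow> bool" where
  "simple_graph V E \<longleftrightarrow> finite V \<and> (\<forall>e\<in>E. e \<subseteq> V \<and> card e = 2)"

text \<open>Subgraphs need not be induced, but they are required to be non-empty.\<close>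

definition graph_subgraph :: "'a set \<Rightarrow> 'a set set \<Rightarrow> 'a set \<Rightarrow> 'a set set \<Rightarrow> bool" where
  "graph_subgraph W F V E \<longleftrightarrow> simple_graph W F \<and> W \<noteq> {} \<and> W \<subseteq> V \<and> F \<subseteq> E"

definition vertex_degree :: "'a set set \<Rightarrow> 'a \<Rightarrow> nat" where
  "vertex_degree E v = card {e \<in> E. v \<in> e}"

text \<open>The value is unspecified for an empty vertex set.\<close>

definition graph_min_degree :: "'a set \<Rightarrow> 'a set set \<Rightarrow> nat" where
  "graph_min_degree V E = Min (vertex_degree E ` V)"

end

theory Submission
  imports Defs
begin

text \<open>Write \<open>excess S\<close> for the number of edges meeting \<open>S\<close> minus \<open>(k - 1) |S|\<close>. In a minimal
  counterexample \<open>excess V = - t\<close>, while \<open>excess S \<ge> 1\<close> for all smaller non-empty \<open>S\<close>. A set of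
  excess 1 can be deleted at the price of increasing \<open>t\<close> by one, which leaves enough edges for a
  subgraph of minimum degree \<open>k\<close>; hence such good sets have size below \<open>n / N\<close>, where \<open>N\<close> is the
  maximum in the statement. By submodularity the maximal good sets are disjoint and non-adjacent;
  they contain all vertices of degree \<open>k\<close>.

  If they cover few vertices, most vertices have bounded degree and no neighbour in a good set, and
  a greedy choice of \<open>n / O(k\<^sup>2)\<close> of them, spread out so that no vertex loses too many neighbours,
  can be deleted.

  Otherwise the maximal good sets are inserted, heaviest first, into \<open>16 k\<close> disjoint zones, each
  closed under absorbing vertices left with fewer than \<open>k\<close> neighbours. A good set is rejected only
  if it makes every zone run into another zone or a rejected set. Each such conflict is caused by an
  absorption that strictly decreases the excess, and one decrease accounts for at most \<open>4 k\<close>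
  conflicts. Since the total decrease is at most the number of good sets plus \<open>t\<close>, few sets are
  rejected, so that some zone is heavy, and its complement has minimum degree \<open>k\<close>.\<close>

section \<open>Counting\<close>

text \<open>Within one row, every overloaded pair takes at least
  \<open>\<theta> - \<alpha> c\<close> from weights that no other pair of the row uses, so a row
  holds at most \<open>l + 1\<close> of them; columns are alike. Summing the loads over
  \<open>S\<close> thus counts each weight at most \<open>l + 1\<close> times. For
  \<open>\<theta> = 1\<close> only \<open>\<gamma>\<close> is nonzero, which saves a factor.\<close>

lemma card_overloaded_pairs:
  fixes \<alpha> :: "'c \<Rightarrow> nat" and \<beta> :: "'x \<Rightarrow> nat" and \<gamma> :: "'c \<times> 'x \<Rightarrow> nat"
  assumes fin: "finite C" "finite X" and S: "S \<subseteq> C \<times> X"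
    and heavy: "\<And>c x. (c, x) \<in> S \<Longrightarrow> \<theta> \<le> \<alpha> c + \<beta> x + \<gamma> (c, x)"
    and \<alpha>: "\<And>c. c \<in> C \<Longrightarrow> \<alpha> c < \<theta>" and \<beta>: "\<And>x. x \<in> X \<Longrightarrow> \<beta> x < \<theta>"
    and total: "sum \<alpha> C + sum \<beta> X + sum \<gamma> (C \<times> X) \<le> \<theta> + l"
    and \<theta>: "\<theta> \<ge> 1"
  shows "card S \<le> (l + 1)\<^sup>2" and "\<theta> = 1 \<Longrightarrow> card S \<le> l + 1"
proof -
  have finS: "finite S" using S fin finite_subset by blast
  have sumS: "sum \<gamma> S \<le> sum \<gamma> (C \<times> X)"
    using S fin by (intro sum_mono2) auto
  \<comment> \<open>At most \<open>l + (\<theta> - a)\<close> is left for \<open>n\<close> demands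
    of \<open>\<theta> - a \<ge> 1\<close> each.\<close>
  have bd: "n \<le> l + 1" if "a < \<theta>" "a + n * (\<theta> - a) \<le> \<theta> + l" for a n :: nat
  proof (rule ccontr)
    assume "\<not> n \<le> l + 1"
    then have "n \<ge> l + 2" by simp
    then have "(l + 2) * (\<theta> - a) \<le> n * (\<theta> - a)" by (rule mult_le_mono1)
    moreover have "(l + 2) * (\<theta> - a) = l * (\<theta> - a) + 2 * (\<theta> - a)"
      by (rule add_mult_distrib)
    moreover have "l * 1 \<le> l * (\<theta> - a)" using that(1) by (intro mult_le_mono2) simp
    ultimately show False using that by linarith
  qed
  have row: "card {x. (c, x) \<in> S} \<le> l + 1" if c: "c \<in> C" for c
  proof (rule bd)
    let ?R = "{x. (c, x) \<in> S}"
    have R: "?R \<subseteq> X" using S by auto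
    have "card ?R * (\<theta> - \<alpha> c) = (\<Sum>x\<in>?R. \<theta> - \<alpha> c)" by simp
    also have "\<dots> \<le> (\<Sum>x\<in>?R. \<beta> x + \<gamma> (c, x))"
      using heavy by (intro sum_mono) fastforce
    also have "\<dots> = sum \<beta> ?R + (\<Sum>x\<in>?R. \<gamma> (c, x))" by (rule sum.distrib)
    also have "(\<Sum>x\<in>?R. \<gamma> (c, x)) = sum \<gamma> (Pair c ` ?R)"
      by (subst sum.reindex) (auto simp: inj_on_def)
    also have "\<dots> \<le> sum \<gamma> (C \<times> X)"
      using R fin c by (intro sum_mono2) auto
    also have "sum \<beta> ?R \<le> sum \<beta> X" using R fin by (intro sum_mono2) auto
    finally have 1: "card ?R * (\<theta> - \<alpha> c) \<le> sum \<beta> X + sum \<gamma> (C \<times> X)" by simp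
    have "\<alpha> c \<le> sum \<alpha> C" using c fin by (intro member_le_sum) auto
    then show "\<alpha> c + card ?R * (\<theta> - \<alpha> c) \<le> \<theta> + l" using 1 total by linarith
  qed (use \<alpha> c in auto)
  have col: "card {c. (c, x) \<in> S} \<le> l + 1" if x: "x \<in> X" for x
  proof (rule bd)
    let ?R = "{c. (c, x) \<in> S}"
    have R: "?R \<subseteq> C" using S by auto
    have "card ?R * (\<theta> - \<beta> x) = (\<Sum>c\<in>?R. \<theta> - \<beta> x)" by simp
    also have "\<dots> \<le> (\<Sum>c\<in>?R. \<alpha> c + \<gamma> (c, x))"
      using heavy by (intro sum_mono) fastforce
    also have "\<dots> = sum \<alpha> ?R + (\<Sum>c\<in>?R. \<gamma> (c, x))" by (rule sum.distrib)
    also have "(\<Sum>c\<in>?R. \<gamma> (c, x)) = sum \<gamma> ((\<lambda>c. (c, x)) ` ?R)"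
      by (subst sum.reindex) (auto simp: inj_on_def)
    also have "\<dots> \<le> sum \<gamma> (C \<times> X)"
      using R fin x by (intro sum_mono2) auto
    also have "sum \<alpha> ?R \<le> sum \<alpha> C" using R fin by (intro sum_mono2) auto
    finally have 1: "card ?R * (\<theta> - \<beta> x) \<le> sum \<alpha> C + sum \<gamma> (C \<times> X)" by simp
    have "\<beta> x \<le> sum \<beta> X" using x fin by (intro member_le_sum) auto
    then show "\<beta> x + card ?R * (\<theta> - \<beta> x) \<le> \<theta> + l" using 1 total by linarith
  qed (use \<beta> x in auto)
  have SC: "S = Sigma C (\<lambda>c. {x. (c, x) \<in> S})" using S by auto
  have sum\<alpha>: "(\<Sum>p\<in>S. \<alpha> (fst p)) \<le> (l + 1) * sum \<alpha> C"
  proof -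
    have "(\<Sum>p\<in>S. \<alpha> (fst p)) = (\<Sum>p\<in>Sigma C (\<lambda>c. {x. (c, x) \<in> S}). \<alpha> (fst p))"
      using SC by simp
    also have "\<dots> = (\<Sum>c\<in>C. \<Sum>x\<in>{x. (c, x) \<in> S}. \<alpha> c)"
      using fin S by (subst sum.Sigma) (auto intro: finite_subset[of _ X] simp: case_prod_beta)
    also have "\<dots> = (\<Sum>c\<in>C. card {x. (c, x) \<in> S} * \<alpha> c)" by simp
    also have "\<dots> \<le> (\<Sum>c\<in>C. (l + 1) * \<alpha> c)" by (intro sum_mono mult_le_mono1 row)
    finally show ?thesis by (simp add: sum_distrib_left)
  qed
  have sum\<beta>: "(\<Sum>p\<in>S. \<beta> (snd p)) \<le> (l + 1) * sum \<beta> X"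
  proof -
    have "(\<Sum>p\<in>S. \<beta> (snd p)) = (\<Sum>p\<in>prod.swap ` S. \<beta> (fst p))"
      by (subst sum.reindex) (auto simp: inj_on_def)
    also have "prod.swap ` S = Sigma X (\<lambda>x. {c. (c, x) \<in> S})" using S by (force simp: image_iff)
    also have "(\<Sum>p\<in>Sigma X (\<lambda>x. {c. (c, x) \<in> S}). \<beta> (fst p)) = (\<Sum>x\<in>X. \<Sum>c\<in>{c. (c, x) \<in> S}. \<beta> x)"
      using fin S by (subst sum.Sigma) (auto intro: finite_subset[of _ C] simp: case_prod_beta)
    also have "\<dots> = (\<Sum>x\<in>X. card {c. (c, x) \<in> S} * \<beta> x)" by simp
    also have "\<dots> \<le> (\<Sum>x\<in>X. (l + 1) * \<beta> x)" by (intro sum_mono mult_le_mono1 col)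
    finally show ?thesis by (simp add: sum_distrib_left)
  qed
  have "\<theta> * card S = (\<Sum>p\<in>S. \<theta>)" by simp
  also have "\<dots> \<le> (\<Sum>p\<in>S. \<alpha> (fst p) + \<beta> (snd p) + \<gamma> p)"
    using heavy by (intro sum_mono) auto
  also have "\<dots> = (\<Sum>p\<in>S. \<alpha> (fst p)) + (\<Sum>p\<in>S. \<beta> (snd p)) + sum \<gamma> S"
    by (simp add: sum.distrib)
  finally have main: "\<theta> * card S \<le> (\<Sum>p\<in>S. \<alpha> (fst p)) + (\<Sum>p\<in>S. \<beta> (snd p)) + sum \<gamma> S" .
  also have "\<dots> \<le> (l + 1) * sum \<alpha> C + (l + 1) * sum \<beta> X + (l + 1) * sum \<gamma> (C \<times> X)"
    using sum\<alpha> sum\<beta> sumS by (intro add_mono) (auto intro: order_trans)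
  also have "\<dots> = (l + 1) * (sum \<alpha> C + sum \<beta> X + sum \<gamma> (C \<times> X))" by (simp add: algebra_simps)
  also have "\<dots> \<le> (l + 1) * (\<theta> + l)" by (intro mult_le_mono2 total)
  also have "\<dots> \<le> (l + 1) * (\<theta> * (l + 1))"
  proof (intro mult_le_mono2)
    have "1 * l \<le> \<theta> * l" by (intro mult_le_mono1 \<theta>)
    then show "\<theta> + l \<le> \<theta> * (l + 1)" by (simp add: algebra_simps)
  qed
  also have "\<dots> = \<theta> * (l + 1)\<^sup>2" by (simp add: power2_eq_square algebra_simps)
  finally show "card S \<le> (l + 1)\<^sup>2" using \<theta> by simp
  assume t1: "\<theta> = 1"
  have "(\<Sum>p\<in>S. \<alpha> (fst p)) = 0" "(\<Sum>p\<in>S. \<beta> (snd p)) = 0"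
    using S \<alpha> \<beta> t1 by (auto intro!: sum.neutral)
  then show "card S \<le> l + 1" using main sumS total t1 by simp
qed

section \<open>Sums over unions and level sets\<close>

lemma sum_UN_le:
  fixes w :: "'a \<Rightarrow> nat"
  assumes "finite I" "\<And>i. i \<in> I \<Longrightarrow> finite (A i)"
  shows "sum w (\<Union>i\<in>I. A i) \<le> (\<Sum>i\<in>I. sum w (A i))"
  using assms
proof (induction I rule: finite_induct)
  case (insert i I)
  then have "sum w (A i \<union> (\<Union>i\<in>I. A i)) + sum w (A i \<inter> (\<Union>i\<in>I. A i))
      = sum w (A i) + sum w (\<Union>i\<in>I. A i)"
    by (intro sum.union_inter) auto
  then show ?case using insert by simp
qed simp

lemma ex_sum_le_card_mult:
  fixes f :: "'a \<Rightarrow> nat"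
  assumes "finite I" "I \<noteq> {}"
  obtains i where "i \<in> I" "sum f I \<le> card I * f i"
proof -
  have "\<exists>i\<in>I. sum f I \<le> card I * f i"
  proof (rule ccontr)
    assume "\<not> ?thesis"
    then have "(\<Sum>i\<in>I. card I * f i) < (\<Sum>i\<in>I. sum f I)"
      using assms by (intro sum_strict_mono) (auto simp: not_le)
    then show False by (simp add: sum_distrib_left[symmetric])
  qed
  with that show thesis by blast
qed

text \<open>Layer-cake summation: it turns a bound on every level set of the rejected sources into a
  bound on their total weight.\<close>

lemma sum_eq_sum_card_levels:
  fixes w :: "'a \<Rightarrow> nat"
  assumes "finite A" "\<And>x. x \<in> A \<Longrightarrow> w x \<le> M"
  shows "sum w A = (\<Sum>h=1..M. card {x \<in> A. h \<le> w x})"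
proof -
  have "sum w A = (\<Sum>x\<in>A. \<Sum>h=1..M. if h \<le> w x then 1 else 0)"
  proof (intro sum.cong refl)
    fix x assume x: "x \<in> A"
    have "{1..M} \<inter> {h. h \<le> w x} = {1..w x}" using assms(2)[OF x] by auto
    then show "w x = (\<Sum>h=1..M. if h \<le> w x then 1 else 0)" by (simp add: sum.If_cases)
  qed
  also have "\<dots> = (\<Sum>h=1..M. \<Sum>x\<in>A. if h \<le> w x then 1 else 0)" by (rule sum.swap)
  also have "\<dots> = (\<Sum>h=1..M. card {x \<in> A. h \<le> w x})"
    using assms(1) by (intro sum.cong refl) (simp add: sum.If_cases Int_def)
  finally show ?thesis .
qed

section \<open>Absorption\<close>

text \<open>In the application the units are the maximal good sets and the remaining vertices, \<open>a\<close> counts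
  the edges between two units, \<open>\<theta>\<close> is the excess of a unit, \<open>F\<close> is the excess of a union, and \<open>S\<close>
  consists of the maximal good sets. A unit \<open>u\<close> is absorbed by \<open>X\<close> as soon as \<open>\<theta> u\<close> edges join it
  to \<open>X\<close>; for a vertex this means that it has fewer than \<open>k\<close> neighbours outside \<open>X\<close>.\<close>

locale unit_system =
  fixes U :: "'u set" and a :: "'u \<Rightarrow> 'u \<Rightarrow> nat" and \<theta> :: "'u \<Rightarrow> nat"
    and F :: "'u set \<Rightarrow> int" and S :: "'u set" and k t :: nat
  assumes finite_U: "finite U" and a_sym: "a u v = a v u"
    and \<theta>_pos: "u \<in> U \<Longrightarrow> 1 \<le> \<theta> u"
    and F_empty: "F {} = 0"
    and F_insert: "\<lbrakk>u \<in> U; X \<subseteq> U; u \<notin> X\<rbrakk> \<Longrightarrow> F (insert u X) = F X + int (\<theta> u) - int (sum (a u) X)"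
    and F_lower: "X \<subseteq> U \<Longrightarrow> - int t \<le> F X"
    and degree: "\<lbrakk>u \<in> U; X \<subseteq> U - {u}; \<theta> u \<noteq> 1\<rbrakk> \<Longrightarrow> sum (a u) X \<le> \<theta> u + k"
    and S_subset: "S \<subseteq> U" and \<theta>_S: "s \<in> S \<Longrightarrow> \<theta> s = 1"
    and a_S: "\<lbrakk>s \<in> S; u \<in> U; u \<noteq> s\<rbrakk> \<Longrightarrow> a u s < \<theta> u"
    and k_pos: "1 \<le> k"
begin

text \<open>Deleting such a \<open>Z\<close> is safe: an outside good set
  (\<open>\<theta> = 1\<close>) has no edge to \<open>Z\<close>, and an outside vertex, where
  \<open>\<theta>\<close> is the degree minus \<open>k - 1\<close>, keeps at least \<open>k\<close>
  neighbours.\<close>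

definition stable :: "'u set \<Rightarrow> bool" where
  "stable Z \<longleftrightarrow> Z \<subseteq> U \<and> (\<forall>v\<in>U - Z. sum (a v) Z < \<theta> v)"

text \<open>Units enter one at a time; no step increases \<open>F\<close>, and inductions can charge
  to the decrease. The set reached need not be closed.\<close>

inductive absorb :: "'u set \<Rightarrow> 'u set \<Rightarrow> bool" for X where
  refl: "absorb X X"
| step: "\<lbrakk>absorb X Y; u \<in> U; u \<notin> Y; \<theta> u \<le> sum (a u) Y\<rbrakk> \<Longrightarrow> absorb X (insert u Y)"

lemma finite_subset_U: "X \<subseteq> U \<Longrightarrow> finite X"
  using finite_U finite_subset by blast

lemma sum_a_mono: "\<lbrakk>X \<subseteq> Y; Y \<subseteq> U\<rbrakk> \<Longrightarrow> sum (a u) X \<le> sum (a u) Y"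
  by (intro sum_mono2) (auto intro: finite_subset_U)

lemma absorb_subset: "absorb X Y \<Longrightarrow> X \<subseteq> Y"
  by (induction rule: absorb.induct) auto

lemma absorb_subset_U: "absorb X Y \<Longrightarrow> X \<subseteq> U \<Longrightarrow> Y \<subseteq> U"
  by (induction rule: absorb.induct) auto

lemma stable_empty: "stable {}"
  using \<theta>_pos by (fastforce simp: stable_def)

lemma absorb_subset_stable: "\<lbrakk>absorb X Y; stable R; X \<subseteq> R\<rbrakk> \<Longrightarrow> Y \<subseteq> R"
proof (induction rule: absorb.induct)
  case (step Y u)
  then have "Y \<subseteq> R" "R \<subseteq> U" by (auto simp: stable_def)
  then have "sum (a u) Y \<le> sum (a u) R" by (rule sum_a_mono)
  then have "u \<in> R" using step by (force simp: stable_def)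
  then show ?case using \<open>Y \<subseteq> R\<close> by simp
qed

lemma closure_exists:
  assumes "X \<subseteq> U"
  obtains Y where "absorb X Y" "stable Y"
proof -
  let ?C = "{Y. absorb X Y}"
  have "?C \<subseteq> Pow U" using absorb_subset_U assms by auto
  then have "finite ?C" using finite_U finite_subset by blast
  moreover have "?C \<noteq> {}" using absorb.refl by auto
  ultimately obtain Y where Y: "absorb X Y" and max: "\<And>Y'. absorb X Y' \<Longrightarrow> Y \<subseteq> Y' \<Longrightarrow> Y' = Y"
    using finite_has_maximal[of ?C] by auto
  have "stable Y" unfolding stable_def
  proof (intro conjI ballI)
    show "Y \<subseteq> U" using Y absorb_subset_U assms by blast
    fix v assume "v \<in> U - Y"
    then show "sum (a v) Y < \<theta> v"
      using max[of "insert v Y"] absorb.step[OF Y, of v] by fastforce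
  qed
  with Y that show thesis by blast
qed

text \<open>A unit outside \<open>B\<close> sends at least as many edges to
  \<open>B \<union> Y\<close> as to \<open>Y\<close>, so closing up one zone does not increase
  \<open>F\<close> of everything placed so far.\<close>

lemma F_absorb_le:
  assumes "absorb X Y" "X \<subseteq> B" "B \<subseteq> U"
  shows "F (B \<union> Y) \<le> F B"
  using assms
proof (induction rule: absorb.induct)
  case refl
  then show ?case by (simp add: Un_absorb2)
next
  case (step Y u)
  show ?case
  proof (cases "u \<in> B")
    case True
    then show ?thesis using step by (simp add: insert_absorb)
  next
    case False
    have Y: "Y \<subseteq> U" using step absorb_subset_U by blast
    have "sum (a u) Y \<le> sum (a u) (B \<union> Y)" using step Y by (intro sum_a_mono) auto
    moreover have "F (insert u (B \<union> Y)) = F (B \<union> Y) + int (\<theta> u) - int (sum (a u) (B \<union> Y))"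
      using step False Y by (intro F_insert) auto
    ultimately show ?thesis using step by (simp del: of_nat_sum)
  qed
qed

text \<open>\<open>R (c, x)\<close> is the part of \<open>T\<close> that is absorbed from the zone \<open>Z c\<close> and the source \<open>x\<close> by
  lossless absorptions alone, where a step absorbing \<open>u\<close> into \<open>T\<close> has loss \<open>sum (a u) T - \<theta> u\<close>. A
  unit absorbed without loss enters \<open>R (c, x)\<close> only if all its edges to earlier units go there, so
  later units of \<open>R (c, x)\<close> are not joined to earlier units outside, and no unit is shared by two
  pairs. The pairs in \<open>B\<close>, for which \<open>R (c, x)\<close> is not closed, are paid for by the losses.\<close>

lemma spread:
  fixes K :: nat
  assumes Z: "\<And>c. c < K \<Longrightarrow> stable (Z c)"
    and disj: "\<And>c c'. \<lbrakk>c < K; c' < K; c \<noteq> c'\<rbrakk> \<Longrightarrow> Z c \<inter> Z c' = {}"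
    and X: "X \<subseteq> S" and ZX: "\<And>c. c < K \<Longrightarrow> Z c \<inter> X = {}"
    and Y: "Y = (\<Union>c<K. Z c) \<union> X"
    and T: "absorb Y T"
  shows "\<exists>R B. B \<subseteq> {..<K} \<times> X \<and> int (card B) \<le> 4 * int k * (F Y - F T)
    \<and> (\<forall>c<K. \<forall>x\<in>X. R (c, x) \<subseteq> T \<and> R (c, x) \<inter> Y = insert x (Z c))
    \<and> (\<forall>p\<in>{..<K} \<times> X. \<forall>q\<in>{..<K} \<times> X. p \<noteq> q \<longrightarrow> R p \<inter> R q \<subseteq> Y)
    \<and> (\<forall>p\<in>{..<K} \<times> X - B. \<forall>v\<in>T - R p. sum (a v) (R p) < \<theta> v)"
  using T
proof (induction rule: absorb.induct)
  case refl
  have YU: "Y \<subseteq> U" using Z X S_subset by (auto simp: Y stable_def)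
  let ?R = "\<lambda>(c, x). insert x (Z c)"
  have "sum (a v) (insert x (Z c)) < \<theta> v"
    if c: "c < K" and x: "x \<in> X" and v: "v \<in> Y - insert x (Z c)" for c x v
  proof -
    have xZ: "x \<notin> Z c" using ZX c x by blast
    have ZU: "Z c \<subseteq> U" using Z c by (auto simp: stable_def)
    \<comment> \<open>Sources have \<open>\<theta> = 1\<close>, so neither another source nor a
      stable zone avoiding \<open>x\<close> has an edge to \<open>x\<close>. Only edges to
      \<open>Z c\<close> count, and \<open>Z c\<close> is stable.\<close>
    have "a v x = 0"
    proof (cases "v \<in> X")
      case True
      then have "a v x < \<theta> v" using a_S[of x v] x X YU v by auto
      then show ?thesis using \<theta>_S True X by auto
    next
      case False
      then obtain c' where c': "c' < K" "v \<in> Z c'" using v by (auto simp: Y)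
      have "x \<in> U - Z c'" using ZX[OF c'(1)] x X S_subset by auto
      then have "sum (a x) (Z c') < \<theta> x" using Z[OF c'(1)] by (auto simp: stable_def)
      then have "sum (a x) (Z c') = 0" using \<theta>_S x X by auto
      moreover have "finite (Z c')" using Z[OF c'(1)] finite_subset_U by (auto simp: stable_def)
      ultimately show ?thesis using c'(2) a_sym[of v x] by auto
    qed
    moreover have "sum (a v) (Z c) < \<theta> v" using Z[OF c] v YU by (auto simp: stable_def)
    ultimately show ?thesis using xZ finite_subset_U[OF ZU] by simp
  qed
  moreover have "?R (c, x) \<subseteq> Y \<and> ?R (c, x) \<inter> Y = insert x (Z c)" if "c < K" "x \<in> X" for c x
    using that by (auto simp: Y)
  moreover have "?R p \<inter> ?R q \<subseteq> Y" if "p \<in> {..<K} \<times> X" for p q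
    using that by (auto simp: Y)
  ultimately show ?case
    by (intro exI[of _ ?R] exI[of _ "{}"]) (simp add: Int_absorb2)
next
  case (step T u)
  from step.IH obtain R B where B: "B \<subseteq> {..<K} \<times> X" "int (card B) \<le> 4 * int k * (F Y - F T)"
    and R1: "\<forall>c<K. \<forall>x\<in>X. R (c, x) \<subseteq> T \<and> R (c, x) \<inter> Y = insert x (Z c)"
    and R2: "\<forall>p\<in>{..<K} \<times> X. \<forall>q\<in>{..<K} \<times> X. p \<noteq> q \<longrightarrow> R p \<inter> R q \<subseteq> Y"
    and R3: "\<forall>p\<in>{..<K} \<times> X - B. \<forall>v\<in>T - R p. sum (a v) (R p) < \<theta> v"
    by (elim exE conjE) (rule that)
  let ?P = "{..<K} \<times> X"
  have RT: "R (c, x) \<subseteq> T" and RY: "R (c, x) \<inter> Y = insert x (Z c)" if "c < K" "x \<in> X" for c x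
    using R1 that by auto
  have RR: "R p \<inter> R q \<subseteq> Y" if "p \<in> ?P" "q \<in> ?P" "p \<noteq> q" for p q
    using R2 that by blast
  have Rc: "sum (a v) (R p) < \<theta> v" if "p \<in> ?P - B" "v \<in> T - R p" for p v
    using R3 that by blast
  have YU: "Y \<subseteq> U" using Z X S_subset by (auto simp: Y stable_def)
  have TU: "T \<subseteq> U" using step(1) YU by (rule absorb_subset_U)
  have YT: "Y \<subseteq> T" using step(1) by (rule absorb_subset)
  have finX: "finite X" using X S_subset finite_subset_U by blast
  have ZU: "Z c \<subseteq> U" if "c < K" for c using Z that by (auto simp: stable_def)
  have uZ: "sum (a u) (Z c) < \<theta> u" if "c < K" for c
    using Z[OF that] step(2,3) YT that by (auto simp: stable_def Y)
  have ux: "a u x < \<theta> u" if "x \<in> X" for x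
    using a_S[of x u] that X step(2,3) YT by (auto simp: Y)
  have uY: "u \<notin> Y" using step(3) YT by auto
  \<comment> \<open>The loss of this step, which is exactly the drop of \<open>F\<close>.\<close>
  define l where "l = sum (a u) T - \<theta> u"
  have uT: "sum (a u) T = \<theta> u + l" using step(4) by (simp add: l_def)
  have FT: "F (insert u T) = F T - int l"
    using F_insert[OF step(2) TU step(3)] uT by simp
  have RTp: "R p \<subseteq> T" if "p \<in> ?P" for p using RT that by auto
  have RU: "R p \<subseteq> U" if "p \<in> ?P" for p using RTp[OF that] TU by auto
  show ?case
  proof (cases "l = 0")
    case True
    define R' where "R' p = (if \<theta> u \<le> sum (a u) (R p) then insert u (R p) else R p)" for p
    have R'R: "v \<in> R' p \<longleftrightarrow> v \<in> R p" if "v \<noteq> u" for v p using that by (auto simp: R'_def)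
    \<comment> \<open>Otherwise at least \<open>\<theta> u\<close> edges from \<open>u\<close> go to
      the overlap of the two sets, as \<open>T\<close> offers only \<open>\<theta> u\<close>. But
      they overlap inside \<open>Y\<close> only, hence within one zone or one source, and neither
      attracts \<open>u\<close> alone.\<close>
    have both: False if p: "p \<in> ?P" and q: "q \<in> ?P" and "p \<noteq> q"
      and up: "\<theta> u \<le> sum (a u) (R p)" and uq: "\<theta> u \<le> sum (a u) (R q)" for p q
    proof -
      have "sum (a u) (R p \<union> R q) + sum (a u) (R p \<inter> R q) = sum (a u) (R p) + sum (a u) (R q)"
        using RU p q finite_subset_U by (intro sum.union_inter) auto
      moreover have "sum (a u) (R p \<union> R q) \<le> sum (a u) T"
        using RTp p q TU by (intro sum_a_mono) auto
      ultimately have *: "\<theta> u \<le> sum (a u) (R p \<inter> R q)" using up uq uT True by linarith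
      obtain c x d y where pq: "p = (c, x)" "q = (d, y)" "c < K" "d < K" "x \<in> X" "y \<in> X"
        using p q by auto
      have "R p \<inter> R q \<subseteq> (R p \<inter> Y) \<inter> (R q \<inter> Y)" using RR[OF p q \<open>p \<noteq> q\<close>] by auto
      also have "\<dots> = insert x (Z c) \<inter> insert y (Z d)" using RY pq by simp
      finally have sub: "R p \<inter> R q \<subseteq> insert x (Z c) \<inter> insert y (Z d)" .
      show False
      proof (cases "c = d")
        case True
        then have "R p \<inter> R q \<subseteq> Z c" using sub \<open>p \<noteq> q\<close> pq by auto
        then have "sum (a u) (R p \<inter> R q) \<le> sum (a u) (Z c)" using ZU pq by (intro sum_a_mono) auto
        then show False using * uZ[of c] pq by simp
      next
        case False
        then have "insert x (Z c) \<inter> insert y (Z d) \<subseteq> {x}"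
          using disj[of c d] ZX[of c] ZX[of d] pq(3-6) by blast
        then have "R p \<inter> R q \<subseteq> {x}" using sub by blast
        then have "sum (a u) (R p \<inter> R q) \<le> sum (a u) {x}"
          using X S_subset pq by (intro sum_a_mono) auto
        then show False using * ux[of x] pq by simp
      qed
    qed
    show ?thesis
    proof (intro exI[of _ R'] exI[of _ B] conjI allI impI ballI)
      show "B \<subseteq> ?P" by (rule B)
      show "int (card B) \<le> 4 * int k * (F Y - F (insert u T))" using B FT True by simp
    next
      fix c x assume "c < K" "x \<in> X"
      then show "R' (c, x) \<subseteq> insert u T" using RT by (auto simp: R'_def)
    next
      fix c x assume "c < K" "x \<in> X"
      then show "R' (c, x) \<inter> Y = insert x (Z c)" using RY uY by (auto simp: R'_def)
    next
      fix p q assume pq: "p \<in> ?P" "q \<in> ?P" "p \<noteq> q"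
      have "u \<notin> R' p \<inter> R' q"
        using both[OF pq] RTp[OF pq(1)] RTp[OF pq(2)] step(3) by (auto simp: R'_def split: if_splits)
      then show "R' p \<inter> R' q \<subseteq> Y" using RR[OF pq] R'R by fastforce
    next
      fix p v assume p: "p \<in> ?P - B" and v: "v \<in> insert u T - R' p"
      have finR: "finite (R p)" using RU p finite_subset_U by blast
      show "sum (a v) (R' p) < \<theta> v"
      proof (cases "v = u")
        case True
        then show ?thesis using v by (auto simp: R'_def split: if_splits)
      next
        case False
        then have vT: "v \<in> T - R p" using v R'R by auto
        show ?thesis
        proof (cases "\<theta> u \<le> sum (a u) (R p)")
          case True
          \<comment> \<open>All edges from \<open>u\<close> to \<open>T\<close> already end in
            \<open>R p\<close>, so \<open>v\<close> is not joined to \<open>u\<close> and its count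
            is unchanged.\<close>
          have "sum (a u) (insert v (R p)) \<le> sum (a u) T"
            using RTp p vT TU by (intro sum_a_mono) auto
          then have "a u v = 0" using vT finR uT \<open>l = 0\<close> True by simp
          then have "a v u = 0" using a_sym[of v u] by simp
          moreover have "u \<notin> R p" using RTp p step(3) by blast
          ultimately show ?thesis using Rc[OF p vT] finR True by (simp add: R'_def)
        next
          case False
          then show ?thesis using Rc[OF p vT] by (simp add: R'_def)
        qed
      qed
    qed
  next
    case False
    \<comment> \<open>With a positive loss no \<open>R p\<close> grows; the pairs that attract
      \<open>u\<close> become exceptional instead.\<close>
    define N where "N = {p \<in> ?P. \<theta> u \<le> sum (a u) (R p)}"
    \<comment> \<open>The zones, the sources and the private parts \<open>R p - Y\<close> are
      pairwise disjoint parts of \<open>T\<close>, so \<open>u\<close> sends at most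
      \<open>\<theta> u + l\<close> edges to all of them together.\<close>
    let ?\<alpha> = "\<lambda>c. sum (a u) (Z c)" and ?\<gamma> = "\<lambda>p. sum (a u) (R p - Y)"
    have total: "sum ?\<alpha> {..<K} + sum (a u) X + sum ?\<gamma> ?P \<le> \<theta> u + l"
    proof -
      have "sum ?\<alpha> {..<K} = sum (a u) (\<Union>c<K. Z c)"
        using disj ZU finite_subset_U by (intro sum.UNION_disjoint[symmetric]) auto
      moreover have "sum ?\<gamma> ?P = sum (a u) (\<Union>p\<in>?P. R p - Y)"
      proof (rule sum.UNION_disjoint[symmetric], goal_cases)
        case 2
        then show ?case using RU finite_subset_U by blast
      next
        case 3
        then show ?case using RR by blast
      qed (use finX in simp)
      moreover have "sum (a u) ((\<Union>c<K. Z c) \<union> X \<union> (\<Union>p\<in>?P. R p - Y))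
          = sum (a u) (\<Union>c<K. Z c) + sum (a u) X + sum (a u) (\<Union>p\<in>?P. R p - Y)"
      proof -
        have f1: "finite (\<Union>c<K. Z c)" using ZU finite_subset_U by auto
        have f2: "finite (\<Union>p\<in>?P. R p - Y)"
          using RU finite_subset_U finX by (intro finite_UN_I) auto
        show ?thesis using f1 f2 finX ZX
          by (subst sum.union_disjoint, simp, simp, force simp: Y, subst sum.union_disjoint) auto
      qed
      moreover have "sum (a u) ((\<Union>c<K. Z c) \<union> X \<union> (\<Union>p\<in>?P. R p - Y)) \<le> sum (a u) T"
        using YT RTp TU by (intro sum_a_mono) (auto simp: Y)
      ultimately show ?thesis using uT by simp
    qed
    have heavy: "\<theta> u \<le> ?\<alpha> c + a u x + ?\<gamma> (c, x)" if "(c, x) \<in> N" for c x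
    proof -
      have cx: "c < K" "x \<in> X" "\<theta> u \<le> sum (a u) (R (c, x))" using that by (auto simp: N_def)
      have "finite (R (c, x))" using RU cx finite_subset_U by auto
      then have "sum (a u) (R (c, x)) = sum (a u) (R (c, x) \<inter> Y) + ?\<gamma> (c, x)"
        by (rule sum.Int_Diff)
      also have "sum (a u) (R (c, x) \<inter> Y) = a u x + ?\<alpha> c"
      proof -
        have "x \<notin> Z c" using ZX[OF cx(1)] cx(2) by blast
        then show ?thesis using RY[OF cx(1,2)] finite_subset_U[OF ZU[OF cx(1)]] by simp
      qed
      finally show ?thesis using cx(3) by simp
    qed
    have NP: "N \<subseteq> {..<K} \<times> X" by (auto simp: N_def)
    note count = card_overloaded_pairs[OF finite_lessThan finX NP heavy _ ux total \<theta>_pos[OF step(2)]]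
    \<comment> \<open>For \<open>\<theta> u = 1\<close> the loss is not bounded by \<open>k\<close>,
      but there the count is linear. Otherwise \<open>degree\<close> gives \<open>l \<le> k\<close>,
      so that \<open>(l + 1)\<^sup>2 \<le> 4 * l * l \<le> 4 * k * l\<close>.\<close>
    have "card N \<le> 4 * k * l"
    proof (cases "\<theta> u = 1")
      case True
      then have "card N \<le> l + 1" using count(2) uZ by simp
      moreover have "1 * l \<le> k * l" using k_pos by (intro mult_le_mono1)
      ultimately show ?thesis using False by linarith
    next
      case nt: False
      have "sum (a u) T \<le> \<theta> u + k" using step(2,3) TU nt by (intro degree) auto
      then have lk: "l \<le> k" using uT by simp
      have "card N \<le> (l + 1)\<^sup>2" using count(1) uZ by simp
      also have "\<dots> \<le> (2 * l)\<^sup>2" using False by (intro power_mono) auto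
      also have "\<dots> = 4 * (l * l)" by (simp add: power2_eq_square)
      also have "\<dots> \<le> 4 * (k * l)" using lk by simp
      finally show ?thesis by simp
    qed
    then have cardN: "int (card N) \<le> 4 * int k * int l"
      by (metis (mono_tags, opaque_lifting) of_nat_le_iff of_nat_mult of_nat_numeral)
    show ?thesis
    proof (intro exI[of _ R] exI[of _ "B \<union> N"] conjI allI impI ballI)
      show "B \<union> N \<subseteq> ?P" using B NP by auto
      have "card (B \<union> N) \<le> card B + card N" by (rule card_Un_le)
      then have "int (card (B \<union> N)) \<le> 4 * int k * (F Y - F T) + 4 * int k * int l"
        using B(2) cardN by linarith
      also have "\<dots> = 4 * int k * (F Y - F (insert u T))"
        unfolding FT by (simp add: algebra_simps)
      finally show "int (card (B \<union> N)) \<le> 4 * int k * (F Y - F (insert u T))" .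
    next
      fix c x assume "c < K" "x \<in> X"
      then show "R (c, x) \<subseteq> insert u T" "R (c, x) \<inter> Y = insert x (Z c)"
        using RT RY by auto
    next
      fix p q assume "p \<in> ?P" "q \<in> ?P" "p \<noteq> q"
      then show "R p \<inter> R q \<subseteq> Y" by (rule RR)
    next
      fix p v assume "p \<in> ?P - (B \<union> N)" "v \<in> insert u T - R p"
      then show "sum (a v) (R p) < \<theta> v" using Rc by (cases "v = u") (auto simp: N_def)
    qed
  qed
qed

text \<open>Let \<open>T\<close> be the closure of \<open>Y\<close>. For a pair outside the
  exceptional set of \<open>spread\<close>, \<open>R (c, x)\<close> is stable and contradicts
  \<open>conflict\<close>; so all pairs with \<open>x \<noteq> s0\<close> are exceptional, while the
  total loss is at most \<open>F Y + t\<close>. The source \<open>s0\<close> is exempt because it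
  will be set aside at the start, not rejected.\<close>

lemma few_rejected:
  fixes K :: nat
  assumes Z: "\<And>c. c < K \<Longrightarrow> stable (Z c)"
    and disj: "\<And>c c'. \<lbrakk>c < K; c' < K; c \<noteq> c'\<rbrakk> \<Longrightarrow> Z c \<inter> Z c' = {}"
    and X: "X \<subseteq> S" and ZX: "\<And>c. c < K \<Longrightarrow> Z c \<inter> X = {}"
    and Y: "Y = (\<Union>c<K. Z c) \<union> X"
    and conflict: "\<And>c x R. \<lbrakk>c < K; x \<in> X - {s0}; stable R; insert x (Z c) \<subseteq> R\<rbrakk>
      \<Longrightarrow> \<not> R \<inter> Y \<subseteq> insert x (Z c)"
  shows "int (K * card (X - {s0})) \<le> 4 * int k * (F Y + int t)"
proof -
  have YU: "Y \<subseteq> U" using Z X S_subset by (auto simp: Y stable_def)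
  obtain T where T: "absorb Y T" "stable T" using closure_exists[OF YU] .
  have TU: "T \<subseteq> U" using T(2) by (auto simp: stable_def)
  have "\<exists>R B. B \<subseteq> {..<K} \<times> X \<and> int (card B) \<le> 4 * int k * (F Y - F T)
    \<and> (\<forall>c<K. \<forall>x\<in>X. R (c, x) \<subseteq> T \<and> R (c, x) \<inter> Y = insert x (Z c))
    \<and> (\<forall>p\<in>{..<K} \<times> X. \<forall>q\<in>{..<K} \<times> X. p \<noteq> q \<longrightarrow> R p \<inter> R q \<subseteq> Y)
    \<and> (\<forall>p\<in>{..<K} \<times> X - B. \<forall>v\<in>T - R p. sum (a v) (R p) < \<theta> v)"
    using Z disj X ZX Y T(1) by (intro spread) simp_all
  then obtain R B where B: "B \<subseteq> {..<K} \<times> X" "int (card B) \<le> 4 * int k * (F Y - F T)"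
    and R: "\<forall>c<K. \<forall>x\<in>X. R (c, x) \<subseteq> T \<and> R (c, x) \<inter> Y = insert x (Z c)"
    and Rc: "\<forall>p\<in>{..<K} \<times> X - B. \<forall>v\<in>T - R p. sum (a v) (R p) < \<theta> v"
    by (elim exE conjE) (rule that)
  have finX: "finite X" using X S_subset finite_subset_U by blast
  have "{..<K} \<times> (X - {s0}) \<subseteq> B"
  proof (rule subrelI, rule ccontr)
    fix c x assume p: "(c, x) \<in> {..<K} \<times> (X - {s0})" and nB: "(c, x) \<notin> B"
    have Rp: "R (c, x) \<subseteq> T" "R (c, x) \<inter> Y = insert x (Z c)" using R p by auto
    have "sum (a v) (R (c, x)) < \<theta> v" if v: "v \<in> U - R (c, x)" for v
    proof (cases "v \<in> T")
      case True
      then show ?thesis using bspec[OF Rc, of "(c, x)"] p nB v by auto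
    next
      case False
      have "sum (a v) (R (c, x)) \<le> sum (a v) T" by (rule sum_a_mono[OF Rp(1) TU])
      also have "\<dots> < \<theta> v" using T(2) v False by (auto simp: stable_def)
      finally show ?thesis .
    qed
    then have "stable (R (c, x))" using Rp(1) TU by (auto simp: stable_def)
    then show False using conflict[of c x "R (c, x)"] p Rp(2) by auto
  qed
  moreover have "finite B" using B(1) finX finite_subset[of B "{..<K} \<times> X"] by blast
  ultimately have "card ({..<K} \<times> (X - {s0})) \<le> card B" by (rule card_mono[rotated])
  then have "int (K * card (X - {s0})) \<le> int (card B)"
    by (simp add: card_cartesian_product del: of_nat_mult)
  also have "\<dots> \<le> 4 * int k * (F Y - F T)" by (rule B(2))
  also have "\<dots> \<le> 4 * int k * (F Y + int t)"
    using F_lower[OF TU] by (intro mult_left_mono) auto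
  finally show ?thesis .
qed

text \<open>The sources are inserted in order of decreasing weight; this is what makes the bound on
  the number of rejected sources hold on every weight level, as the bound of
  \<open>few_rejected\<close> is available at the time of each rejection.\<close>

lemma zones_exist:
  fixes w :: "'u \<Rightarrow> nat" and K :: nat
  assumes s0: "s0 \<in> S" and P: "P \<subseteq> S - {s0}"
  shows "\<exists>Z X. (\<forall>c<K. stable (Z c)) \<and> (\<forall>c<K. \<forall>c'<K. c \<noteq> c' \<longrightarrow> Z c \<inter> Z c' = {})
    \<and> X \<subseteq> insert s0 P \<and> s0 \<in> X \<and> (\<forall>c<K. Z c \<inter> X = {}) \<and> P \<subseteq> (\<Union>c<K. Z c) \<union> X
    \<and> F ((\<Union>c<K. Z c) \<union> X) \<le> int (card P) + 1
    \<and> (\<forall>c<K. \<forall>x\<in>X - {s0}. \<forall>R. stable R \<longrightarrow> insert x (Z c) \<subseteq> R \<longrightarrow>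
          \<not> R \<inter> ((\<Union>c<K. Z c) \<union> X) \<subseteq> insert x (Z c))
    \<and> (\<forall>h. K * card {x \<in> X - {s0}. h \<le> w x} \<le> 4 * k * (card {p \<in> P. h \<le> w p} + 1 + t))"
proof -
  have "finite P" using P S_subset finite_U by (meson Diff_subset finite_subset)
  then show ?thesis using P
  \<comment> \<open>Negated weights make the element inserted last the lightest one. It may already
    belong to \<open>P\<close>.\<close>
  proof (induction rule: finite_ranking_induct[where f = "\<lambda>x. - int (w x)"])
    case empty
    \<comment> \<open>This is the \<open>+ 1\<close> in the bound on \<open>F\<close>; all zones
      start empty.\<close>
    have "F {s0} = 1"
      using F_insert[of s0 "{}"] F_empty s0 S_subset \<theta>_S[OF s0] by auto
    moreover have "{x \<in> {s0} - {s0}. h \<le> w x} = {}" for h by auto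
    ultimately show ?case using stable_empty s0
      by (intro exI[of _ "\<lambda>_. {}"] exI[of _ "{s0}"] conjI) simp_all
  next
    case (insert p P)
    show ?case
    proof (cases "p \<in> P")
      case True
      then show ?thesis using insert.IH insert.prems by (simp only: insert_absorb)
    next
      case pP: False
      have "P \<subseteq> S - {s0}" using insert.prems by simp
      from insert.IH[OF this] obtain Z X where Z': "\<forall>c<K. stable (Z c)"
        and disj': "\<forall>c<K. \<forall>c'<K. c \<noteq> c' \<longrightarrow> Z c \<inter> Z c' = {}"
        and X: "X \<subseteq> insert s0 P" "s0 \<in> X" and ZX': "\<forall>c<K. Z c \<inter> X = {}"
        and PY: "P \<subseteq> (\<Union>c<K. Z c) \<union> X" and FY: "F ((\<Union>c<K. Z c) \<union> X) \<le> int (card P) + 1"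
        and conf': "\<forall>c<K. \<forall>x\<in>X - {s0}. \<forall>R. stable R \<longrightarrow> insert x (Z c) \<subseteq> R \<longrightarrow>
            \<not> R \<inter> ((\<Union>c<K. Z c) \<union> X) \<subseteq> insert x (Z c)"
        and lev: "\<forall>h. K * card {x \<in> X - {s0}. h \<le> w x} \<le> 4 * k * (card {p \<in> P. h \<le> w p} + 1 + t)"
        by (elim exE conjE) (rule that)
      note Z = Z'[rule_format] and disj = disj'[rule_format] and ZX = ZX'[rule_format]
        and conf = conf'[rule_format]
      define Y where "Y = (\<Union>c<K. Z c) \<union> X"
      have XS: "X \<subseteq> S" using X insert.prems s0 by auto
      have YU: "Y \<subseteq> U" using Z XS S_subset by (auto simp: Y_def stable_def)
      have p: "p \<in> S" "p \<noteq> s0" "p \<in> U" "p \<notin> P" using insert.prems S_subset pP by auto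
      have cardP: "card (insert p P) = card P + 1" using insert.hyps pP by simp
      have pX: "p \<notin> X" using X p by auto
      have lev': "K * card {x \<in> X - {s0}. h \<le> w x} \<le> 4 * k * (card {q \<in> insert p P. h \<le> w q} + 1 + t)" for h
      proof -
        have "card {q \<in> P. h \<le> w q} \<le> card {q \<in> insert p P. h \<le> w q}"
          using insert.hyps by (intro card_mono) auto
        then have "4 * k * (card {q \<in> P. h \<le> w q} + 1 + t) \<le> 4 * k * (card {q \<in> insert p P. h \<le> w q} + 1 + t)"
          by (intro mult_le_mono2) simp
        then show ?thesis using lev by (meson le_trans)
      qed
      have Fp: "F (insert p Y) \<le> F Y + 1" if "p \<notin> Y"
        using F_insert[of p Y] p YU that \<theta>_S[OF p(1)] by (simp del: of_nat_sum)
      \<comment> \<open>A zone accepts \<open>p\<close> if both lie in a stable set that meets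
        nothing else placed so far.\<close>
      consider (covered) "p \<in> Y"
        | (accept) c R where "p \<notin> Y" "c < K" "stable R" "insert p (Z c) \<subseteq> R" "R \<inter> Y \<subseteq> Z c"
        | (reject) "p \<notin> Y" "\<And>c R. \<lbrakk>c < K; stable R; insert p (Z c) \<subseteq> R\<rbrakk> \<Longrightarrow> \<not> R \<inter> Y \<subseteq> Z c"
        by blast
      then show ?thesis
      proof cases
        case covered
        show ?thesis
          using Z disj X ZX PY FY conf lev' covered cardP
          by (intro exI[of _ Z] exI[of _ X]) (auto simp: Y_def)
      next
        case accept
        have ZcU: "insert p (Z c) \<subseteq> U" using Z[OF accept(2)] p by (auto simp: stable_def)
        \<comment> \<open>\<open>R\<close> only witnesses that there is room. The zone is enlarged
          to the closure \<open>Q\<close> inside \<open>R\<close>, since for \<open>Q\<close> the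
          value of \<open>F\<close> is controlled.\<close>
        obtain Q where Q: "absorb (insert p (Z c)) Q" "stable Q" using closure_exists[OF ZcU] .
        have QR: "Q \<subseteq> R" by (rule absorb_subset_stable[OF Q(1) accept(3,4)])
        have ZQ: "insert p (Z c) \<subseteq> Q" by (rule absorb_subset[OF Q(1)])
        have QU: "Q \<subseteq> U" using Q(2) by (auto simp: stable_def)
        define Z' where "Z' = Z(c := Q)"
        have Y': "(\<Union>c<K. Z' c) \<union> X = insert p Y \<union> Q"
          using accept(2) ZQ by (auto simp: Z'_def Y_def split: if_splits)
        have QY: "Q \<inter> Y \<subseteq> Z c" using QR accept(5) by auto
        have "F (insert p Y \<union> Q) \<le> F (insert p Y)"
          using p YU accept(2) by (intro F_absorb_le[OF Q(1)]) (auto simp: Y_def)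
        then have FY': "F ((\<Union>c<K. Z' c) \<union> X) \<le> int (card (insert p P)) + 1"
          using Fp[OF accept(1)] FY cardP Y' by (simp add: Y_def)
        have Zdisj: "Q \<inter> Z d = {}" if "d < K" "d \<noteq> c" for d
          using QY disj[of c d] that accept(2) by (auto simp: Y_def)
        have QX: "Q \<inter> X = {}" using QY ZX[of c] accept(2) by (auto simp: Y_def)
        \<comment> \<open>Earlier conflicts persist, since the enlarged zone has the same trace on
          the old \<open>Y\<close>.\<close>
        have conf': "\<not> R' \<inter> (insert p Y \<union> Q) \<subseteq> insert x (Z' d)"
          if d: "d < K" and x: "x \<in> X - {s0}" and R': "stable R'" "insert x (Z' d) \<subseteq> R'" for d x R'
        proof
          assume sub: "R' \<inter> (insert p Y \<union> Q) \<subseteq> insert x (Z' d)"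
          have "insert x (Z d) \<subseteq> R'" using R' ZQ by (auto simp: Z'_def split: if_splits)
          moreover have "R' \<inter> Y \<subseteq> insert x (Z d)"
            using sub QY by (auto simp: Z'_def split: if_splits)
          ultimately show False using conf[of d x R'] d x R' by (simp add: Y_def)
        qed
        show ?thesis
        proof (intro exI[of _ Z'] exI[of _ X] conjI)
          show "\<forall>c<K. stable (Z' c)" using Z Q(2) by (simp add: Z'_def)
          show "\<forall>c<K. \<forall>c'<K. c \<noteq> c' \<longrightarrow> Z' c \<inter> Z' c' = {}"
            using disj Zdisj by (auto simp: Z'_def)
          show "X \<subseteq> insert s0 (insert p P)" "s0 \<in> X" using X by auto
          show "\<forall>c<K. Z' c \<inter> X = {}" using ZX QX by (simp add: Z'_def)
          show "insert p P \<subseteq> (\<Union>c<K. Z' c) \<union> X" unfolding Y' using PY by (auto simp: Y_def)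
        qed (use FY' conf' lev' Y' in auto)
      next
        case reject
        have Y': "(\<Union>c<K. Z c) \<union> insert p X = insert p Y" by (auto simp: Y_def)
        have ZX': "Z c \<inter> insert p X = {}" if "c < K" for c
          using ZX reject(1) that by (auto simp: Y_def)
        have conf': "\<not> R \<inter> insert p Y \<subseteq> insert x (Z c)"
          if c: "c < K" and x: "x \<in> insert p X - {s0}" and R: "stable R" "insert x (Z c) \<subseteq> R" for c x R
        proof
          assume sub: "R \<inter> insert p Y \<subseteq> insert x (Z c)"
          show False
          proof (cases "x = p")
            case True
            then have "R \<inter> Y \<subseteq> Z c" using sub reject(1) by auto
            then show False using reject(2) c R True by auto
          next
            case False
            have "R \<inter> Y \<subseteq> insert x (Z c)" using sub by auto
            then show False using conf[of c x R] c x R False by (auto simp: Y_def)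
          qed
        qed
        have FY': "F (insert p Y) \<le> int (card (insert p P)) + 1"
          using Fp[OF reject(1)] FY cardP by (simp add: Y_def)
        have "int (K * card (insert p X - {s0})) \<le> 4 * int k * (F (insert p Y) + int t)"
          using Z disj XS p(1) ZX' conf' Y' by (intro few_rejected[where Z = Z]) auto
        also have "\<dots> \<le> 4 * int k * (int (card (insert p P)) + 1 + int t)"
          using FY' by (intro mult_left_mono) auto
        also have "\<dots> = int (4 * k * (card (insert p P) + 1 + t))"
          by (simp add: distrib_left)
        finally have few: "K * card (insert p X - {s0}) \<le> 4 * k * (card (insert p P) + 1 + t)"
          by (simp only: of_nat_le_iff)
        have lev'': "K * card {x \<in> insert p X - {s0}. h \<le> w x}
            \<le> 4 * k * (card {q \<in> insert p P. h \<le> w q} + 1 + t)" for h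
        proof (cases "h \<le> w p")
          case True
          \<comment> \<open>As \<open>p\<close> is the lightest source so far, every inserted source
            counts on levels up to \<open>w p\<close>, and the global bound \<open>few\<close>
            suffices there. Higher levels do not change.\<close>
          then have 1: "{q \<in> insert p P. h \<le> w q} = insert p P" using insert.hyps by fastforce
          have "finite (insert p X - {s0})" using XS S_subset finite_subset_U by auto
          then have "card {x \<in> insert p X - {s0}. h \<le> w x} \<le> card (insert p X - {s0})"
            by (intro card_mono) auto
          then have "K * card {x \<in> insert p X - {s0}. h \<le> w x} \<le> K * card (insert p X - {s0})"
            by (rule mult_le_mono2)
          then show ?thesis using few unfolding 1 by linarith
        next
          case False
          then have "{x \<in> insert p X - {s0}. h \<le> w x} = {x \<in> X - {s0}. h \<le> w x}" by auto
          then show ?thesis using lev'[of h] by simp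
        qed
        show ?thesis
        proof (intro exI[of _ Z] exI[of _ "insert p X"] conjI)
          show "insert p P \<subseteq> (\<Union>c<K. Z c) \<union> insert p X" using PY by auto
          show "insert p X \<subseteq> insert s0 (insert p P)" "s0 \<in> insert p X" using X by auto
        qed (use Z disj ZX' FY' conf' lev'' Y' in auto)
      qed
    qed
  qed
qed

text \<open>With \<open>K = 16 * k\<close> the level bounds sum up to a quarter of
  \<open>sum w (S - {s0}) + (t + 1) * M\<close> for the rejected sources. The zones carry the rest,
  and one of at least average weight is taken. Keeping \<open>s0\<close> outside makes the
  complement non-empty.\<close>

lemma heavy_stable_set:
  fixes w :: "'u \<Rightarrow> nat"
  assumes s0: "s0 \<in> S" and M: "\<And>s. s \<in> S \<Longrightarrow> w s \<le> M"
  obtains Z where "stable Z" "s0 \<notin> Z" "3 * sum w (S - {s0}) \<le> 64 * k * sum w Z + (t + 1) * M"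
proof -
  define K where "K = 16 * k"
  define P where "P = S - {s0}"
  have finS: "finite S" using S_subset finite_subset_U by blast
  then have finP: "finite P" by (simp add: P_def)
  obtain Z X where Z: "\<And>c. c < K \<Longrightarrow> stable (Z c)"
    and X: "X \<subseteq> insert s0 P" "s0 \<in> X" and ZX: "\<And>c. c < K \<Longrightarrow> Z c \<inter> X = {}"
    and PY: "P \<subseteq> (\<Union>c<K. Z c) \<union> X"
    and lev: "\<And>h. K * card {x \<in> X - {s0}. h \<le> w x} \<le> 4 * k * (card {p \<in> P. h \<le> w p} + 1 + t)"
    using zones_exist[OF s0, of P K w] by (auto simp: P_def)
  have finX: "finite X" using X finP finite_subset by blast
  have Xw: "sum w (X - {s0}) = (\<Sum>h=1..M. card {x \<in> X - {s0}. h \<le> w x})"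
    using finX X M by (intro sum_eq_sum_card_levels) (auto simp: P_def)
  have Pw: "sum w P = (\<Sum>h=1..M. card {x \<in> P. h \<le> w x})"
    using finP M by (intro sum_eq_sum_card_levels) (auto simp: P_def)
  have "K * sum w (X - {s0}) \<le> (\<Sum>h=1..M. 4 * k * (card {p \<in> P. h \<le> w p} + 1 + t))"
    unfolding Xw sum_distrib_left by (intro sum_mono lev)
  also have "\<dots> = 4 * k * (\<Sum>h=1..M. card {p \<in> P. h \<le> w p} + (t + 1))"
    by (simp add: sum_distrib_left)
  also have "\<dots> = 4 * k * (sum w P + (t + 1) * M)"
    unfolding Pw sum.distrib by simp
  finally have "4 * sum w (X - {s0}) \<le> sum w P + (t + 1) * M"
    using k_pos by (simp add: K_def)
  moreover have "sum w P \<le> (\<Sum>c<K. sum w (Z c)) + sum w (X - {s0})"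
  proof -
    have ZU: "finite (Z c)" if "c < K" for c
      using Z[OF that] finite_subset_U by (auto simp: stable_def)
    have "sum w P \<le> sum w ((\<Union>c<K. Z c) \<union> (X - {s0}))"
      using PY ZU finX by (intro sum_mono2) (auto simp: P_def)
    also have "\<dots> \<le> sum w (\<Union>c<K. Z c) + sum w (X - {s0})"
      using sum.union_inter[of "\<Union>c<K. Z c" "X - {s0}" w] ZU finX by simp
    also have "sum w (\<Union>c<K. Z c) \<le> (\<Sum>c<K. sum w (Z c))"
      using ZU by (intro sum_UN_le) auto
    finally show ?thesis by simp
  qed
  ultimately have main: "3 * sum w P \<le> 4 * (\<Sum>c<K. sum w (Z c)) + (t + 1) * M" by linarith
  have "K > 0" using k_pos by (simp add: K_def)
  then obtain c where c: "c < K" "(\<Sum>c<K. sum w (Z c)) \<le> K * sum w (Z c)"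
    using ex_sum_le_card_mult[of "{..<K}" "\<lambda>c. sum w (Z c)"] by auto
  show thesis
  proof (rule that[of "Z c"])
    show "stable (Z c)" by (rule Z[OF c(1)])
    show "s0 \<notin> Z c" using ZX[OF c(1)] X by auto
    show "3 * sum w (S - {s0}) \<le> 64 * k * sum w (Z c) + (t + 1) * M"
      using main c(2) by (simp add: K_def P_def)
  qed
qed

end

section \<open>Excess of vertex sets\<close>

text \<open>For disjoint sets this is the usual number of edges e(S, T).\<close>

definition between :: "'a set set \<Rightarrow> 'a set \<Rightarrow> 'a set \<Rightarrow> nat" where
  "between E S T = card {e \<in> E. e \<inter> S \<noteq> {} \<and> e \<inter> T \<noteq> {}}"

definition excess :: "'a set set \<Rightarrow> nat \<Rightarrow> 'a set \<Rightarrow> int" where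
  "excess E k S = int (card {e \<in> E. e \<inter> S \<noteq> {}}) - (int k - 1) * int (card S)"

text \<open>The sought subgraph is recorded by its vertex set alone; taking all edges inside it can
  only raise degrees.\<close>

definition core :: "'a set set \<Rightarrow> nat \<Rightarrow> 'a set \<Rightarrow> bool" where
  "core E k W \<longleftrightarrow> W \<noteq> {} \<and> (\<forall>v\<in>W. k \<le> vertex_degree {e \<in> E. e \<subseteq> W} v)"

lemma simple_graph_finite: "simple_graph V E \<Longrightarrow> finite V \<and> finite E"
  using finite_subset[of E "Pow V"] by (auto simp: simple_graph_def)

lemma simple_graph_delete: "simple_graph V E \<Longrightarrow> simple_graph (V - X) {e \<in> E. e \<subseteq> V - X}"
  by (auto simp: simple_graph_def)

lemma core_mono:
  assumes "core E k W" "E \<subseteq> E'" "finite E'"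
  shows "core E' k W"
proof -
  have "vertex_degree {e \<in> E. e \<subseteq> W} v \<le> vertex_degree {e \<in> E'. e \<subseteq> W} v" for v
    unfolding vertex_degree_def using assms by (intro card_mono) auto
  then show ?thesis using assms(1) unfolding core_def by (meson order_trans)
qed

lemma between_commute: "between E S T = between E T S"
  unfolding between_def by (rule arg_cong[where f = card]) auto

lemma between_empty [simp]: "between E S {} = 0"
  by (simp add: between_def)

text \<open>An edge has two ends, so it cannot meet three disjoint sets.\<close>

lemma between_Un:
  assumes G: "simple_graph V E" and disj: "S \<inter> T = {}" "S \<inter> T' = {}" "T \<inter> T' = {}"
  shows "between E S (T \<union> T') = between E S T + between E S T'"
proof -
  let ?A = "\<lambda>T. {e \<in> E. e \<inter> S \<noteq> {} \<and> e \<inter> T \<noteq> {}}"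
  have "?A T \<inter> ?A T' = {}"
  proof (rule equals0I)
    fix e assume "e \<in> ?A T \<inter> ?A T'"
    then obtain x y z where xyz: "x \<in> e \<inter> S" "y \<in> e \<inter> T" "z \<in> e \<inter> T'" and e: "e \<in> E" by blast
    have "card {x, y, z} = 3" using xyz disj by (auto simp: card_insert_if)
    moreover have "card e = 2" using e G by (auto simp: simple_graph_def)
    moreover have "{x, y, z} \<subseteq> e" using xyz by auto
    ultimately show False using card_mono[of e "{x, y, z}"] card.infinite[of e] by fastforce
  qed
  moreover have "?A (T \<union> T') = ?A T \<union> ?A T'" by auto
  ultimately show ?thesis
    unfolding between_def using simple_graph_finite[OF G] by (simp add: card_Un_disjoint)
qed

lemma between_Union:
  assumes G: "simple_graph V E" and "finite \<X>"
    and "\<And>X. X \<in> \<X> \<Longrightarrow> S \<inter> X = {}" "\<And>X Y. \<lbrakk>X \<in> \<X>; Y \<in> \<X>; X \<noteq> Y\<rbrakk> \<Longrightarrow> X \<inter> Y = {}"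
  shows "between E S (\<Union>\<X>) = (\<Sum>X\<in>\<X>. between E S X)"
  using assms(2-)
proof (induction \<X> rule: finite_induct)
  case (insert X \<X>)
  have "X \<inter> \<Union>\<X> = {}" using insert.prems(2)[of X] insert.hyps(2) by blast
  moreover have "S \<inter> \<Union>\<X> = {}" "S \<inter> X = {}" using insert.prems(1) by blast+
  ultimately have "between E S (X \<union> \<Union>\<X>) = between E S X + between E S (\<Union>\<X>)"
    by (intro between_Un[OF G])
  then show ?case using insert by simp
qed simp

lemma between_mono:
  assumes "finite E" "S \<subseteq> S'"
  shows "between E S T \<le> between E S' T"
  unfolding between_def using assms by (intro card_mono) auto

lemma excess_empty [simp]: "excess E k {} = 0"
  by (simp add: excess_def)

lemma excess_singleton: "excess E k {v} = int (vertex_degree E v) - (int k - 1)"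
  by (simp add: excess_def vertex_degree_def)

lemma excess_Un:
  assumes "finite E" "finite S" "finite T" "S \<inter> T = {}"
  shows "excess E k (S \<union> T) = excess E k S + excess E k T - int (between E S T)"
proof -
  let ?A = "\<lambda>S. {e \<in> E. e \<inter> S \<noteq> {}}"
  have "card (?A S) + card (?A T) = card (?A S \<union> ?A T) + card (?A S \<inter> ?A T)"
    using assms by (intro card_Un_Int) auto
  moreover have "?A S \<union> ?A T = ?A (S \<union> T)" by auto
  moreover have "card (?A S \<inter> ?A T) = between E S T"
    unfolding between_def by (rule arg_cong[where f = card]) auto
  moreover have "card (S \<union> T) = card S + card T" using assms by (simp add: card_Un_disjoint)
  ultimately show ?thesis by (simp add: excess_def algebra_simps)
qed

text \<open>An edge meeting \<open>S \<inter> T\<close> meets both sets, but not conversely; the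
  size terms cancel.\<close>

lemma excess_submodular:
  assumes "finite E" "finite S" "finite T"
  shows "excess E k (S \<union> T) + excess E k (S \<inter> T) \<le> excess E k S + excess E k T"
proof -
  let ?A = "\<lambda>S. {e \<in> E. e \<inter> S \<noteq> {}}"
  have "card (?A S) + card (?A T) = card (?A S \<union> ?A T) + card (?A S \<inter> ?A T)"
    using assms by (intro card_Un_Int) auto
  moreover have "?A S \<union> ?A T = ?A (S \<union> T)" by auto
  moreover have "card (?A (S \<inter> T)) \<le> card (?A S \<inter> ?A T)"
    using assms by (intro card_mono) auto
  ultimately have "int (card (?A (S \<union> T))) + int (card (?A (S \<inter> T))) \<le> int (card (?A S)) + int (card (?A T))"
    by simp
  moreover have "(int k - 1) * int (card (S \<union> T)) + (int k - 1) * int (card (S \<inter> T))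
      = (int k - 1) * int (card S) + (int k - 1) * int (card T)"
    using card_Un_Int[OF assms(2,3)] by (metis distrib_left of_nat_add)
  ultimately show ?thesis by (simp add: excess_def)
qed

section \<open>Deleting vertices and finding cores\<close>

lemma card_edges_delete:
  assumes G: "simple_graph V E"
  shows "card {e \<in> E. e \<subseteq> V - X} + card {e \<in> E. e \<inter> X \<noteq> {}} = card E"
proof -
  have "{e \<in> E. e \<subseteq> V - X} \<union> {e \<in> E. e \<inter> X \<noteq> {}} = E"
    using G by (auto simp: simple_graph_def)
  moreover have "{e \<in> E. e \<subseteq> V - X} \<inter> {e \<in> E. e \<inter> X \<noteq> {}} = {}" by auto
  ultimately show ?thesis
    using simple_graph_finite[OF G]
    by (metis (no_types, lifting) card_Un_disjoint finite_Un)
qed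

lemma degree_delete:
  assumes G: "simple_graph V E" and v: "v \<notin> X"
  shows "vertex_degree {e \<in> E. e \<subseteq> V - X} v + between E {v} X = vertex_degree E v"
proof -
  let ?A = "{e \<in> {e \<in> E. e \<subseteq> V - X}. v \<in> e}" and ?B = "{e \<in> E. e \<inter> {v} \<noteq> {} \<and> e \<inter> X \<noteq> {}}"
  have "?A \<union> ?B = {e \<in> E. v \<in> e}" using G by (auto simp: simple_graph_def)
  moreover have "?A \<inter> ?B = {}" by auto
  ultimately have "card ?A + card ?B = card {e \<in> E. v \<in> e}"
    using simple_graph_finite[OF G] card_Un_disjoint[of ?A ?B] by simp
  then show ?thesis unfolding vertex_degree_def between_def .
qed

lemma core_delete:
  assumes G: "simple_graph V E" and "V - X \<noteq> {}"
    and "\<And>v. v \<in> V - X \<Longrightarrow> k + between E {v} X \<le> vertex_degree E v"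
  shows "core E k (V - X)"
  unfolding core_def
proof (intro conjI ballI)
  fix v assume v: "v \<in> V - X"
  then show "k \<le> vertex_degree {e \<in> E. e \<subseteq> V - X} v"
    using assms(3)[OF v] degree_delete[OF G, of v X] by simp
qed (rule assms(2))

lemma card_edges_le:
  assumes "simple_graph V E"
  shows "2 * card E \<le> card V * (card V - 1)"
proof -
  have "card E \<le> card {e. e \<subseteq> V \<and> card e = 2}"
    using assms by (intro card_mono) (auto simp: simple_graph_def)
  also have "\<dots> = card V choose 2"
    using assms by (intro n_subsets) (simp add: simple_graph_def)
  also have "\<dots> = card V * (card V - 1) div 2" by (rule choose_two)
  finally show ?thesis by linarith
qed

text \<open>Deleting a vertex of degree below \<open>k\<close> costs at most \<open>k - 1\<close>
  edges and preserves the edge bound. The constant \<open>(k - 2) * (k + 1)\<close> stops this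
  process before the vertices run out.\<close>

lemma core_exists:
  assumes "simple_graph V E" "2 \<le> k" "k - 1 \<le> card V"
    and "2 * (int k - 1) * int (card V) \<le> 2 * int (card E) + (int k - 2) * (int k + 1)"
  shows "\<exists>W\<subseteq>V. core E k W"
  using assms
proof (induction "card V" arbitrary: V E)
  case 0
  then show ?case by simp
next
  case (Suc m)
  note G = Suc.prems(1)
  have fin: "finite V" "finite E" using simple_graph_finite[OF G] by auto
  show ?case
  proof (cases "\<exists>v\<in>V. vertex_degree E v < k")
    case True
    then obtain v where v: "v \<in> V" "vertex_degree E v < k" by blast
    have c: "card V = card (V - {v}) + 1" using v fin by (simp add: Suc.hyps(2)[symmetric])
    show ?thesis
    \<comment> \<open>On \<open>k - 1\<close> vertices the edge bound exceeds
      \<open>(k - 1) * (k - 2) / 2\<close>, the number of pairs, by one.\<close>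
    proof (cases "k - 1 = card V")
      case True
      have "2 * card E \<le> (k - 1) * (k - 2)" using card_edges_le[OF G] unfolding True[symmetric] by (simp add: numeral_2_eq_2)
      then have "2 * int (card E) \<le> int ((k - 1) * (k - 2))" by linarith
      also have "\<dots> = (int k - 1) * (int k - 2)" using Suc.prems(2) by (simp add: of_nat_diff)
      finally have "2 * int (card E) \<le> (int k - 1) * (int k - 2)" .
      moreover have "int (card V) = int k - 1" using True Suc.prems(2) by linarith
      ultimately have "2 * (int k - 1) * (int k - 1) \<le> (int k - 1) * (int k - 2) + (int k - 2) * (int k + 1)"
        using Suc.prems(4) by simp
      then have False by (simp add: algebra_simps)
      then show ?thesis ..
    next
      case False
      let ?E = "{e \<in> E. e \<subseteq> V - {v}}"
      have "card ?E + vertex_degree E v = card E"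
        using card_edges_delete[OF G, of "{v}"] by (simp add: vertex_degree_def)
      then have "int (card E) \<le> int (card ?E) + (int k - 1)" using v(2) by linarith
      moreover have "2 * (int k - 1) * int (card V) = 2 * (int k - 1) * int (card (V - {v})) + 2 * (int k - 1)"
        unfolding c by (simp add: algebra_simps)
      ultimately have "2 * (int k - 1) * int (card (V - {v})) \<le> 2 * int (card ?E) + (int k - 2) * (int k + 1)"
        using Suc.prems(4) by (simp add: algebra_simps)
      moreover have "k - 1 \<le> card (V - {v})" using Suc.prems(3) False c by linarith
      moreover have "m = card (V - {v})" using Suc.hyps(2) c by linarith
      ultimately obtain W where W: "W \<subseteq> V - {v}" "core ?E k W"
        using Suc.hyps(1)[OF _ simple_graph_delete[OF G] Suc.prems(2)] by blast
      have "core E k W" by (rule core_mono[OF W(2) _ fin(2)]) auto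
      then show ?thesis using W(1) by blast
    qed
  next
    case False
    have "{e \<in> E. e \<subseteq> V} = E" using G by (auto simp: simple_graph_def)
    moreover have "V \<noteq> {}" using Suc.hyps(2) by auto
    ultimately have "core E k V" using False by (auto simp: core_def)
    then show ?thesis by blast
  qed
qed

text \<open>A maximal independent set dominates \<open>A\<close>: each element belongs to it or is
  related to a member.\<close>

lemma independent_set_exists:
  assumes fin: "finite A" and sym: "\<And>u v. R u v \<Longrightarrow> R v u" and irr: "\<And>u. \<not> R u u"
    and deg: "\<And>u. u \<in> A \<Longrightarrow> card {v \<in> A. R u v} \<le> d"
  obtains S where "S \<subseteq> A" "\<And>u v. \<lbrakk>u \<in> S; v \<in> S\<rbrakk> \<Longrightarrow> \<not> R u v" "card A \<le> card S * (d + 1)"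
proof -
  define I where "I = {S. S \<subseteq> A \<and> (\<forall>u\<in>S. \<forall>v\<in>S. \<not> R u v)}"
  have "I \<subseteq> Pow A" by (auto simp: I_def)
  then have "finite I" using fin finite_subset by blast
  moreover have "{} \<in> I" by (simp add: I_def)
  ultimately obtain S where S': "S \<in> I" and max: "\<forall>S'\<in>I. S \<subseteq> S' \<longrightarrow> S = S'"
    using finite_has_maximal[of I] by blast
  have S: "S \<subseteq> A" "\<And>u v. \<lbrakk>u \<in> S; v \<in> S\<rbrakk> \<Longrightarrow> \<not> R u v" using S' by (auto simp: I_def)
  have finS: "finite S" using S fin finite_subset by blast
  have "A \<subseteq> (\<Union>u\<in>S. insert u {v \<in> A. R u v})"
  proof
    fix v assume v: "v \<in> A"
    show "v \<in> (\<Union>u\<in>S. insert u {v \<in> A. R u v})"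
    proof (rule ccontr)
      assume n: "\<not> ?thesis"
      then have "\<not> R u v" "\<not> R v u" if "u \<in> S" for u using that v sym by blast+
      then have "insert v S \<in> I" using S v irr by (auto simp: I_def)
      then have "S = insert v S" using max by blast
      then show False using n by blast
    qed
  qed
  then have "card A \<le> card (\<Union>u\<in>S. insert u {v \<in> A. R u v})"
    using finS fin by (intro card_mono) auto
  also have "\<dots> \<le> (\<Sum>u\<in>S. card (insert u {v \<in> A. R u v}))" by (rule card_UN_le[OF finS])
  also have "\<dots> \<le> (\<Sum>u\<in>S. d + 1)"
    using S deg fin by (intro sum_mono) (auto simp: card_insert_if le_SucI)
  finally have "card A \<le> card S * (d + 1)" by simp
  with S that show thesis by blast
qed

section \<open>Degrees and neighbourhoods\<close>

lemma sum_vertex_degree: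
  assumes "simple_graph V E"
  shows "(\<Sum>v\<in>V. vertex_degree E v) = 2 * card E"
proof -
  have fin: "finite V" "finite E" using simple_graph_finite[OF assms] by auto
  have "(\<Sum>v\<in>V. vertex_degree E v) = (\<Sum>v\<in>V. \<Sum>e\<in>{e \<in> E. v \<in> e}. 1)"
    by (simp add: vertex_degree_def)
  also have "\<dots> = (\<Sum>e\<in>E. \<Sum>v\<in>{v \<in> V. v \<in> e}. 1)" by (rule sum.swap_restrict[OF fin])
  also have "\<dots> = (\<Sum>e\<in>E. 2)"
  proof (intro sum.cong refl)
    fix e assume "e \<in> E"
    then have "e \<subseteq> V" "card e = 2" using assms by (auto simp: simple_graph_def)
    moreover from this have "{v \<in> V. v \<in> e} = e" by auto
    ultimately show "(\<Sum>v\<in>{v \<in> V. v \<in> e}. 1) = (2::nat)" by simp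
  qed
  finally show ?thesis by simp
qed

definition nbrs :: "'a set set \<Rightarrow> 'a \<Rightarrow> 'a set" where
  "nbrs E v = {u. {v, u} \<in> E}"

lemma nbrs_sym: "u \<in> nbrs E v \<Longrightarrow> v \<in> nbrs E u"
  by (simp add: nbrs_def insert_commute)

lemma nbrs_subset: "simple_graph V E \<Longrightarrow> nbrs E v \<subseteq> V"
  by (auto simp: nbrs_def simple_graph_def)

text \<open>Removing \<open>v\<close> from \<open>e\<close> lets one statement serve twice:
  \<open>S = UNIV\<close> gives the degree, and \<open>v \<notin> S\<close> gives
  \<open>between\<close>.\<close>

lemma card_incident_edges:
  assumes "simple_graph V E"
  shows "card {e \<in> E. v \<in> e \<and> (e - {v}) \<inter> S \<noteq> {}} = card (nbrs E v \<inter> S)"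
proof -
  have "{e \<in> E. v \<in> e \<and> (e - {v}) \<inter> S \<noteq> {}} = (\<lambda>u. {v, u}) ` (nbrs E v \<inter> S)"
  proof (intro equalityI subsetI)
    fix e assume e: "e \<in> {e \<in> E. v \<in> e \<and> (e - {v}) \<inter> S \<noteq> {}}"
    then obtain u where u: "u \<in> e" "u \<noteq> v" "u \<in> S" by blast
    have "card e = 2" using e assms by (auto simp: simple_graph_def)
    moreover have "card {v, u} = 2" using u by simp
    ultimately have "{v, u} = e"
      using e u by (intro card_subset_eq) (auto intro: card_ge_0_finite)
    then show "e \<in> (\<lambda>u. {v, u}) ` (nbrs E v \<inter> S)" using e u by (auto simp: nbrs_def)
  next
    fix e assume "e \<in> (\<lambda>u. {v, u}) ` (nbrs E v \<inter> S)"
    then obtain u where u: "e = {v, u}" "u \<in> S" "e \<in> E" by (auto simp: nbrs_def)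
    moreover have "u \<noteq> v" using u assms by (auto simp: simple_graph_def)
    ultimately show "e \<in> {e \<in> E. v \<in> e \<and> (e - {v}) \<inter> S \<noteq> {}}" by auto
  qed
  moreover have "inj_on (\<lambda>u. {v, u}) (nbrs E v \<inter> S)"
    by (rule inj_onI) (auto simp: doubleton_eq_iff)
  ultimately show ?thesis by (simp add: card_image)
qed

lemma vertex_degree_eq_card_nbrs:
  assumes "simple_graph V E"
  shows "vertex_degree E v = card (nbrs E v)"
proof -
  have "(e - {v}) \<inter> UNIV \<noteq> {}" if "e \<in> E" for e
  proof
    assume "(e - {v}) \<inter> UNIV = {}"
    then have "card e \<le> card {v}" by (intro card_mono) auto
    then show False using that assms by (auto simp: simple_graph_def)
  qed
  then have "{e \<in> E. v \<in> e} = {e \<in> E. v \<in> e \<and> (e - {v}) \<inter> UNIV \<noteq> {}}" by blast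
  then show ?thesis using card_incident_edges[OF assms, of v UNIV] by (simp add: vertex_degree_def)
qed

lemma between_eq_card_nbrs:
  assumes "simple_graph V E" "v \<notin> S"
  shows "between E {v} S = card (nbrs E v \<inter> S)"
proof -
  have "{e \<in> E. e \<inter> {v} \<noteq> {} \<and> e \<inter> S \<noteq> {}} = {e \<in> E. v \<in> e \<and> (e - {v}) \<inter> S \<noteq> {}}"
    using assms(2) by blast
  then show ?thesis using card_incident_edges[OF assms(1)] by (simp add: between_def)
qed

section \<open>Maximal good sets\<close>

text \<open>The properties of a minimal counterexample. \<open>excess_pos\<close> will hold since
  deleting a set of excess at most 0 preserves the edge bound; its size condition leaves the
  \<open>k - 1\<close> vertices that the induction needs.\<close>

locale tight_graph =
  fixes V :: "'a set" and E :: "'a set set" and k t :: nat and N :: real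
  assumes graph: "simple_graph V E"
    and k_ge: "3 \<le> k" and t_ge: "1 \<le> t" and t_le: "2 * int t + 2 \<le> (int k - 2) * (int k + 1)"
    and card_E: "int (card E) = (int k - 1) * int (card V) - int t"
    and card_V: "k - 1 \<le> card V"
    and N_k: "10 ^ 4 * (real k)\<^sup>2 \<le> N" and N_t: "100 * real k * real t \<le> N"
    and excess_pos: "\<lbrakk>X \<subseteq> V; X \<noteq> {}; card X + (k - 1) \<le> card V\<rbrakk> \<Longrightarrow> 1 \<le> excess E k X"
    and no_small_core: "\<lbrakk>W \<subseteq> V; core E k W\<rbrakk> \<Longrightarrow> \<not> real (card W) \<le> (1 - 1 / N) * real (card V)"
begin

abbreviation exc :: "'a set \<Rightarrow> int" where "exc \<equiv> excess E k"

section \<open>First consequences of minimality\<close>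

lemma finite_V: "finite V" and finite_E: "finite E"
  using simple_graph_finite[OF graph] by auto

lemma finite_sub: "X \<subseteq> V \<Longrightarrow> finite X"
  using finite_V finite_subset by blast

lemma N_pos: "0 < N"
proof -
  have "0 < 10 ^ 4 * (real k)\<^sup>2" using k_ge by simp
  then show ?thesis using N_k by linarith
qed

lemma N_ge: "10 ^ 4 * real k \<le> N"
proof -
  have "real k * 1 \<le> real k * real k" using k_ge by (intro mult_left_mono) auto
  then show ?thesis using N_k by (simp add: power2_eq_square)
qed

lemma card_core_gt:
  assumes "X \<subseteq> V" "core E k (V - X)"
  shows "real (card X) < real (card V) / N"
proof -
  have "real (card (V - X)) = real (card V) - real (card X)"
    using assms(1) finite_V by (simp add: card_Diff_subset finite_subset of_nat_diff card_mono)
  moreover have "\<not> real (card (V - X)) \<le> (1 - 1 / N) * real (card V)"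
    using no_small_core[of "V - X"] assms by auto
  ultimately show ?thesis by (simp add: algebra_simps)
qed

text \<open>On \<open>k - 1\<close> vertices there is no room for the edges. The conclusion makes
  \<open>excess_pos\<close> applicable to single vertices.\<close>

lemma card_V_ge: "k \<le> card V"
proof (rule ccontr)
  assume "\<not> k \<le> card V"
  then have n: "card V = k - 1" using card_V by simp
  have "2 * card E \<le> (k - 1) * (k - 2)" using card_edges_le[OF graph] n by (simp add: numeral_2_eq_2)
  then have "2 * int (card E) \<le> int ((k - 1) * (k - 2))" by linarith
  also have "\<dots> = (int k - 1) * (int k - 2)" using k_ge by (simp add: of_nat_diff)
  finally have "2 * int (card E) \<le> (int k - 1) * (int k - 2)" .
  moreover have "int (card V) = int k - 1" using n k_ge by linarith
  ultimately show False using card_E t_le by (simp add: algebra_simps)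
qed

text \<open>The critical case is a complement of \<open>y < k - 1\<close> vertices:
  \<open>exc X\<close> is \<open>(k - 1) * y - t\<close> minus the number of edges inside the
  complement, which is at most \<open>(k - 1) * y\<close>.\<close>

lemma excess_lower:
  assumes "X \<subseteq> V"
  shows "- int t \<le> exc X"
proof (cases "X \<noteq> {} \<and> card X + (k - 1) \<le> card V")
  case True
  then have "1 \<le> exc X" using assms by (intro excess_pos) auto
  then show ?thesis by simp
next
  case False
  show ?thesis
  proof (cases "X = {}")
    case False': False
    define y where "y = card (V - X)"
    have cV: "card V = card X + y"
      using card_Diff_subset[OF finite_sub[OF assms] assms] card_mono[OF finite_V assms] by (simp add: y_def)
    then have y: "y < k - 1" using False False' by auto
    let ?E = "{e \<in> E. e \<subseteq> V - X}"
    have "2 * card ?E \<le> y * (y - 1)"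
      using card_edges_le[OF simple_graph_delete[OF graph]] by (simp add: y_def)
    also have "\<dots> \<le> y * (k - 1)" using y by (intro mult_le_mono2) simp
    finally have "card ?E \<le> y * (k - 1)" by simp
    then have "int (card ?E) \<le> int (y * (k - 1))" by (simp only: of_nat_le_iff)
    then have "int (card ?E) \<le> int y * (int k - 1)" using k_ge by (simp add: of_nat_diff)
    moreover have "int (card ?E) + int (card {e \<in> E. e \<inter> X \<noteq> {}}) = int (card E)"
      using card_edges_delete[OF graph, of X] by linarith
    ultimately show ?thesis using card_E unfolding cV excess_def by (simp add: algebra_simps)
  qed simp
qed

lemma degree_ge:
  assumes "v \<in> V"
  shows "k \<le> vertex_degree E v"
  using excess_pos[of "{v}"] assms card_V_ge k_ge excess_singleton[of E k v] by simp

text \<open>Deleting \<open>X\<close> leaves at least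
  \<open>(k - 1) * card (V - X) - (t + 1)\<close> edges. The \<open>- 1\<close> in the bound on
  \<open>t\<close> makes this enough for a core, which avoids \<open>X\<close>.\<close>

lemma excess_le_1_imp_small:
  assumes "X \<subseteq> V" "exc X \<le> 1" "card X + (k - 1) \<le> card V"
  shows "real (card X) < real (card V) / N"
proof -
  let ?E = "{e \<in> E. e \<subseteq> V - X}"
  have cX: "card (V - X) = card V - card X" "card X \<le> card V"
    using assms(1) finite_V by (auto simp: card_Diff_subset finite_subset card_mono)
  then have cX': "int (card (V - X)) = int (card V) - int (card X)" by simp
  have "int (card ?E) + int (card {e \<in> E. e \<inter> X \<noteq> {}}) = int (card E)"
    using card_edges_delete[OF graph, of X] by linarith
  then have "2 * (int k - 1) * int (card (V - X)) \<le> 2 * int (card ?E) + (int k - 2) * (int k + 1)"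
    using assms(2) card_E t_le unfolding excess_def cX' by (simp add: algebra_simps)
  moreover have "2 \<le> k" "k - 1 \<le> card (V - X)" using k_ge assms(3) cX by linarith+
  ultimately obtain W where W: "W \<subseteq> V - X" "core ?E k W"
    using core_exists[OF simple_graph_delete[OF graph]] by blast
  have "core E k W" by (rule core_mono[OF W(2) _ finite_E]) auto
  then have "\<not> real (card W) \<le> (1 - 1 / N) * real (card V)" using no_small_core W by auto
  moreover have "real (card W) \<le> real (card (V - X))"
    using W(1) finite_V by (simp add: card_mono)
  ultimately show ?thesis using cX by (simp add: algebra_simps of_nat_diff)
qed

text \<open>The size bound matters: \<open>V\<close> has excess \<open>- t\<close>, so without it
  \<open>V\<close> would be the only maximal set.\<close>

definition good :: "'a set \<Rightarrow> bool" where
  "good X \<longleftrightarrow> X \<subseteq> V \<and> X \<noteq> {} \<and> exc X \<le> 1 \<and> real (card X) < real (card V) / N"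

text \<open>A non-empty set below \<open>card V / N\<close> forces
  \<open>card V > N \<ge> 10 ^ 4 * k\<close>, so there is ample room. The \<open>+ 1\<close> lets
  \<open>Y\<close> be a single vertex.\<close>

lemma small_card:
  assumes "X \<subseteq> V" "Y \<subseteq> V" "X \<noteq> {}" "real (card X) < real (card V) / N" "real (card Y) \<le> real (card V) / N + 1"
  shows "card (X \<union> Y) + (k - 1) \<le> card V"
proof -
  have "1 \<le> real (card X)" using assms(1,3) finite_sub by (simp add: Suc_leI card_gt_0_iff)
  then have "1 < real (card V) / N" using assms(4) by linarith
  then have nN: "N < real (card V)" using N_pos by (simp add: field_simps)
  have k4: "10000 * real k \<le> N" using N_ge by simp
  then have "real (card V) / N \<le> real (card V) / 10000"
    using k_ge N_pos by (intro divide_left_mono) auto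
  moreover have "card (X \<union> Y) \<le> card X + card Y" by (rule card_Un_le)
  then have "real (card (X \<union> Y)) \<le> real (card X) + real (card Y)" by linarith
  ultimately have "real (card (X \<union> Y)) + (real k - 1) \<le> real (card V)"
    using assms(4,5) nN k4 by linarith
  then show ?thesis using k_ge by linarith
qed

lemma good_Un:
  assumes "good X" "Y \<subseteq> V" "real (card Y) \<le> real (card V) / N + 1" "exc (X \<union> Y) \<le> 1"
  shows "good (X \<union> Y)"
  using assms small_card[of X Y] excess_le_1_imp_small[of "X \<union> Y"] by (auto simp: good_def)

definition maxgood :: "'a set set" where
  "maxgood = {C. good C \<and> (\<forall>C'. good C' \<longrightarrow> C \<subseteq> C' \<longrightarrow> C' = C)}"

lemma maxgood_subset: "C \<in> maxgood \<Longrightarrow> C \<subseteq> V"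
  by (auto simp: maxgood_def good_def)

lemma maxgood_finite: "C \<in> maxgood \<Longrightarrow> finite C"
  using maxgood_subset finite_sub by blast

lemma maxgood_card: "C \<in> maxgood \<Longrightarrow> real (card C) < real (card V) / N"
  by (auto simp: maxgood_def good_def)

lemma maxgood_ne: "C \<in> maxgood \<Longrightarrow> C \<noteq> {}"
  by (auto simp: maxgood_def good_def)

lemma finite_maxgood: "finite maxgood"
  using finite_subset[of maxgood "Pow V"] maxgood_subset finite_V by auto

lemma maxgood_card_bound:
  assumes "C \<in> maxgood"
  shows "card C + (k - 1) \<le> card V"
  using small_card[of C "{}"] maxgood_subset[OF assms] maxgood_ne[OF assms] maxgood_card[OF assms] N_pos
  by simp

lemma maxgood_excess:
  assumes "C \<in> maxgood"
  shows "exc C = 1"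
proof -
  have "1 \<le> exc C"
    by (rule excess_pos[OF maxgood_subset[OF assms] maxgood_ne[OF assms] maxgood_card_bound[OF assms]])
  moreover have "exc C \<le> 1" using assms by (simp add: maxgood_def good_def)
  ultimately show ?thesis by simp
qed

lemma good_subset_maxgood:
  assumes "good X"
  obtains C where "C \<in> maxgood" "X \<subseteq> C"
proof -
  have "finite {C. good C}" using finite_subset[of "{C. good C}" "Pow V"] finite_V by (auto simp: good_def)
  then obtain C where "C \<in> {C. good C}" "X \<subseteq> C" "\<forall>C'\<in>{C. good C}. C \<subseteq> C' \<longrightarrow> C = C'"
    using finite_has_maximal2[of "{C. good C}" X] assms by (auto simp del: mem_Collect_eq simp: mem_Collect_eq[of X])
  then show thesis using that[of C] by (auto simp: maxgood_def)
qed

text \<open>Uncrossing: a non-empty intersection has excess at least 1, so the union has excess at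
  most 1 and is good.\<close>

lemma maxgood_disjoint:
  assumes C: "C \<in> maxgood" "D \<in> maxgood" "C \<noteq> D"
  shows "C \<inter> D = {}"
proof (rule ccontr)
  assume ne: "C \<inter> D \<noteq> {}"
  have fin: "finite C" "finite D" using C maxgood_finite by auto
  have sub: "C \<subseteq> V" "D \<subseteq> V" using C maxgood_subset by auto
  have "card C + (k - 1) \<le> card V" by (rule maxgood_card_bound[OF C(1)])
  moreover have "card (C \<inter> D) \<le> card C" using fin by (intro card_mono) auto
  ultimately have "1 \<le> exc (C \<inter> D)" using ne sub by (intro excess_pos) auto
  then have "exc (C \<union> D) \<le> 1"
    using excess_submodular[OF finite_E fin, of k] maxgood_excess[OF C(1)] maxgood_excess[OF C(2)] by linarith
  then have "good (C \<union> D)"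
    using good_Un[of C D] C sub maxgood_card[OF C(2)] by (auto simp: maxgood_def)
  then have "C \<union> D = C" "C \<union> D = D" using C unfolding maxgood_def by blast+
  then show False using C by auto
qed

text \<open>Otherwise \<open>C \<union> Y\<close> would be a larger good set. If \<open>Y\<close> is
  another maximal good set, this says that no edge joins the two.\<close>

lemma between_maxgood_less:
  assumes C: "C \<in> maxgood" and Y: "Y \<subseteq> V" "Y \<noteq> {}" "Y \<inter> C = {}" "real (card Y) \<le> real (card V) / N + 1"
  shows "int (between E Y C) < exc Y"
proof (rule ccontr)
  assume "\<not> ?thesis"
  then have "exc (C \<union> Y) \<le> 1"
    using excess_Un[OF finite_E maxgood_finite[OF C] finite_sub[OF Y(1)], of k] Y(3)
      maxgood_excess[OF C] between_commute[of E Y C] by (auto simp: Int_commute)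
  then have "good (C \<union> Y)" using good_Un[of C Y] C Y by (auto simp: maxgood_def)
  then have "C \<union> Y = C" using C unfolding maxgood_def by blast
  then show False using Y by blast
qed

lemma degree_ge_Suc:
  assumes "v \<in> V - \<Union>maxgood"
  shows "k + 1 \<le> vertex_degree E v"
proof (rule ccontr)
  assume "\<not> ?thesis"
  then have d: "vertex_degree E v = k" using degree_ge[of v] assms by simp
  have e: "exc {v} \<le> 1" using d by (simp add: excess_singleton)
  have "good {v}"
    using assms e excess_le_1_imp_small[of "{v}"] card_V_ge k_ge by (auto simp: good_def)
  then show False using good_subset_maxgood[of "{v}"] assms by blast
qed

subsection \<open>Few vertices in good sets\<close>

lemma finite_nbrs: "finite (nbrs E v)"
  using nbrs_subset[OF graph] finite_sub by blast

text \<open>The union has excess at most the number of maximal good sets, which is at most the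
  number of its vertices.\<close>

lemma card_meeting_maxgood: "card {e \<in> E. e \<inter> \<Union>maxgood \<noteq> {}} \<le> k * card (\<Union>maxgood)"
proof -
  have exc: "exc (\<Union>\<X>) \<le> int (card \<X>)" if "finite \<X>" "\<X> \<subseteq> maxgood" for \<X>
    using that
  proof (induction \<X> rule: finite_induct)
    case (insert C \<X>)
    have "C \<inter> \<Union>\<X> = {}" using maxgood_disjoint[of C] insert.hyps insert.prems by blast
    moreover have "finite C" "finite (\<Union>\<X>)" using maxgood_finite insert by auto
    ultimately show ?case
      using excess_Un[OF finite_E, of C "\<Union>\<X>" k] insert maxgood_excess[of C] by simp
  qed simp
  have "card (\<Union>maxgood) = sum card maxgood"
    using maxgood_disjoint maxgood_finite
    by (intro card_Union_disjoint) (auto simp: pairwise_def disjnt_def)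
  moreover have "(\<Sum>C\<in>maxgood. 1) \<le> sum card maxgood"
    using maxgood_ne maxgood_finite by (intro sum_mono) (simp add: Suc_leI card_gt_0_iff)
  ultimately have "card maxgood \<le> card (\<Union>maxgood)" by simp
  then have "exc (\<Union>maxgood) \<le> int (card (\<Union>maxgood))"
    using exc[OF finite_maxgood] by fastforce
  then have "int (card {e \<in> E. e \<inter> \<Union>maxgood \<noteq> {}}) \<le> int (k * card (\<Union>maxgood))"
    by (simp add: excess_def algebra_simps)
  then show ?thesis by (simp only: of_nat_le_iff)
qed

lemma card_adjacent_maxgood:
  "card {v \<in> V - \<Union>maxgood. between E {v} (\<Union>maxgood) \<noteq> 0} \<le> k * card (\<Union>maxgood)"
proof -
  let ?A = "\<Union>maxgood"
  let ?M = "{e \<in> E. e \<inter> ?A \<noteq> {}}"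
  have fin: "finite ?M" using finite_E by simp
  have one: "card (e - ?A) \<le> 1" and fe: "finite e" if "e \<in> ?M" for e
  proof -
    obtain a where a: "a \<in> e" "a \<in> ?A" using \<open>e \<in> ?M\<close> by blast
    have e2: "card e = 2" using \<open>e \<in> ?M\<close> graph by (auto simp: simple_graph_def)
    then show fe: "finite e" using card.infinite by fastforce
    have "card (e - ?A) \<le> card (e - {a})" using fe a by (intro card_mono) auto
    then show "card (e - ?A) \<le> 1" using a e2 fe by simp
  qed
  have "{v \<in> V - ?A. between E {v} ?A \<noteq> 0} \<subseteq> (\<Union>e\<in>?M. e - ?A)"
  proof
    fix v assume v: "v \<in> {v \<in> V - ?A. between E {v} ?A \<noteq> 0}"
    then have "{e \<in> E. e \<inter> {v} \<noteq> {} \<and> e \<inter> ?A \<noteq> {}} \<noteq> {}"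
      unfolding between_def by (metis (mono_tags, lifting) card.empty mem_Collect_eq)
    then show "v \<in> (\<Union>e\<in>?M. e - ?A)" using v by blast
  qed
  then have "card {v \<in> V - ?A. between E {v} ?A \<noteq> 0} \<le> card (\<Union>e\<in>?M. e - ?A)"
    using fin fe by (intro card_mono finite_UN_I) auto
  also have "\<dots> \<le> (\<Sum>e\<in>?M. card (e - ?A))" by (rule card_UN_le[OF fin])
  also have "\<dots> \<le> (\<Sum>e\<in>?M. 1)" by (intro sum_mono one)
  also have "\<dots> \<le> k * card ?A" using card_meeting_maxgood by simp
  finally show ?thesis .
qed

text \<open>Markov's inequality for the degree minus \<open>k\<close>, which is non-negative with
  average below \<open>k\<close>.\<close>

lemma card_high_degree: "4 * card {v \<in> V. 5 * k \<le> vertex_degree E v} \<le> card V"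
proof -
  let ?H = "{v \<in> V. 5 * k \<le> vertex_degree E v}"
  have "k * card V + 4 * k * card ?H = (\<Sum>v\<in>V. k + (if v \<in> ?H then 4 * k else 0))"
    using finite_V by (simp add: sum.distrib sum.If_cases Int_def)
  also have "\<dots> \<le> (\<Sum>v\<in>V. vertex_degree E v)" using degree_ge by (intro sum_mono) auto
  also have "\<dots> = 2 * card E" by (rule sum_vertex_degree[OF graph])
  finally have "int (k * card V + 4 * k * card ?H) \<le> int (2 * card E)" by (simp only: of_nat_le_iff)
  then have "int k * (4 * int (card ?H)) \<le> (int k - 2) * int (card V)"
    using card_E by (simp add: algebra_simps)
  also have "\<dots> \<le> int k * int (card V)" by (intro mult_right_mono) auto
  finally have "4 * int (card ?H) \<le> int (card V)" using k_ge by simp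
  then show ?thesis by linarith
qed

text \<open>Neighbours of good sets are excluded because good sets may contain vertices of degree
  exactly \<open>k\<close>, which can lose no edge.\<close>

definition low :: "'a set" where
  "low = {v \<in> V - \<Union>maxgood. vertex_degree E v < 5 * k \<and> between E {v} (\<Union>maxgood) = 0}"

text \<open>Good sets with their neighbours, and vertices of high degree, each make up at most a
  quarter.\<close>

lemma card_low:
  assumes "4 * real (k + 1) * real (card (\<Union>maxgood)) \<le> real (card V)"
  shows "card V \<le> 2 * card low"
proof -
  let ?A = "\<Union>maxgood" and ?H = "{v \<in> V. 5 * k \<le> vertex_degree E v}"
  let ?B = "{v \<in> V - ?A. between E {v} ?A \<noteq> 0}"
  have A: "finite ?A" using finite_maxgood maxgood_finite by auto
  have "finite low" using finite_V by (simp add: low_def)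
  then have "card V \<le> card (?A \<union> ?B \<union> ?H \<union> low)"
    using A finite_V by (intro card_mono) (auto simp: low_def)
  also have "\<dots> \<le> card (?A \<union> ?B \<union> ?H) + card low" by (rule card_Un_le)
  also have "card (?A \<union> ?B \<union> ?H) \<le> card (?A \<union> ?B) + card ?H" by (rule card_Un_le)
  also have "card (?A \<union> ?B) \<le> card ?A + card ?B" by (rule card_Un_le)
  finally have "card V \<le> card ?A + card ?B + card ?H + card low" by simp
  moreover have "card ?B \<le> k * card ?A" by (rule card_adjacent_maxgood)
  moreover have "real (4 * (card ?A + k * card ?A)) \<le> real (card V)" using assms by (simp add: algebra_simps)
  then have "4 * card ?A + 4 * (k * card ?A) \<le> card V" by (simp only: of_nat_le_iff distrib_left)
  moreover note card_high_degree
  ultimately show ?thesis by simp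
qed

text \<open>Two neighbours of a vertex conflict if they lie in the same cell. All neighbours of a vertex
  of low degree form one cell, while those of a vertex of high degree are paired up. Deleting an
  independent set of this relation thus costs a vertex of low degree at most one neighbour, and a
  vertex of high degree about half of its neighbours.\<close>

lemma many_maxgood: "\<not> 4 * real (k + 1) * real (card (\<Union>maxgood)) \<le> real (card V)"
proof
  assume asm: "4 * real (k + 1) * real (card (\<Union>maxgood)) \<le> real (card V)"
  have "\<forall>v. \<exists>g. inj_on g (nbrs E v) \<and> g ` nbrs E v = {0..<vertex_degree E v}"
    using ex_bij_betw_finite_nat[OF finite_nbrs] vertex_degree_eq_card_nbrs[OF graph]
    by (simp add: bij_betw_def)
  then obtain g where g: "\<And>v. inj_on (g v) (nbrs E v)" "\<And>v. g v ` nbrs E v = {0..<vertex_degree E v}"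
    by metis
  \<comment> \<open>\<open>g v\<close> numbers the neighbours of \<open>v\<close>; halving the
    number pairs them up.\<close>
  define cell where "cell v u = (if vertex_degree E v < 5 * k then 0 else g v u div 2)" for v u
  define R where "R u u' \<longleftrightarrow> u \<noteq> u' \<and> (\<exists>v\<in>nbrs E u \<inter> nbrs E u'. cell v u = cell v u')" for u u'
  have finlow: "finite low" using finite_V by (simp add: low_def)
  \<comment> \<open>There are fewer than \<open>5 * k\<close> choices for the common neighbour, and
    at most \<open>5 * k\<close> members of its cell.\<close>
  have conf: "card {u' \<in> low. R u u'} \<le> 25 * k\<^sup>2" if u: "u \<in> low" for u
  proof -
    have cell: "card {u' \<in> nbrs E v. cell v u = cell v u'} \<le> 5 * k" if "v \<in> nbrs E u" for v
    proof (cases "vertex_degree E v < 5 * k")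
      case True
      have "card {u' \<in> nbrs E v. cell v u = cell v u'} \<le> card (nbrs E v)"
        using finite_nbrs by (intro card_mono) auto
      then show ?thesis using True vertex_degree_eq_card_nbrs[OF graph, of v] by linarith
    next
      case False
      define q where "q = g v u div 2"
      have "card {u' \<in> nbrs E v. cell v u = cell v u'} = card (g v ` {u' \<in> nbrs E v. cell v u = cell v u'})"
        using g(1)[of v] by (intro card_image[symmetric]) (auto elim: inj_on_subset)
      also have "\<dots> \<le> card {2 * q, 2 * q + 1}"
        using False by (intro card_mono) (auto simp: cell_def q_def)
      also have "\<dots> \<le> 5 * k" using k_ge by simp
      finally show ?thesis .
    qed
    have "{u' \<in> low. R u u'} \<subseteq> (\<Union>v\<in>nbrs E u. {u' \<in> nbrs E v. cell v u = cell v u'})"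
    proof
      fix u' assume "u' \<in> {u' \<in> low. R u u'}"
      then obtain v where v: "v \<in> nbrs E u" "v \<in> nbrs E u'" "cell v u = cell v u'"
        by (auto simp: R_def)
      have "u' \<in> nbrs E v" by (rule nbrs_sym[OF v(2)])
      then show "u' \<in> (\<Union>v\<in>nbrs E u. {u' \<in> nbrs E v. cell v u = cell v u'})" using v by blast
    qed
    then have "card {u' \<in> low. R u u'} \<le> card (\<Union>v\<in>nbrs E u. {u' \<in> nbrs E v. cell v u = cell v u'})"
      using finite_nbrs by (intro card_mono) auto
    also have "\<dots> \<le> (\<Sum>v\<in>nbrs E u. card {u' \<in> nbrs E v. cell v u = cell v u'})"
      by (rule card_UN_le[OF finite_nbrs])
    also have "\<dots> \<le> (\<Sum>v\<in>nbrs E u. 5 * k)" by (intro sum_mono cell)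
    also have "\<dots> = vertex_degree E u * (5 * k)" by (simp add: vertex_degree_eq_card_nbrs[OF graph])
    also have "\<dots> \<le> 5 * k * (5 * k)" using u by (intro mult_le_mono1) (simp add: low_def)
    finally show ?thesis by (simp add: power2_eq_square)
  qed
  obtain S where S: "S \<subseteq> low" "\<And>u v. \<lbrakk>u \<in> S; v \<in> S\<rbrakk> \<Longrightarrow> \<not> R u v" "card low \<le> card S * (25 * k\<^sup>2 + 1)"
  proof (rule independent_set_exists[OF finlow _ _ conf])
    show "R v u" if "R u v" for u v using that unfolding R_def by force
  qed (auto simp: R_def)
  have SV: "S \<subseteq> V" using S(1) by (auto simp: low_def)
  have finS: "finite S" using SV finite_sub by blast
  have inj: "inj_on (cell v) (nbrs E v \<inter> S)" for v
  proof (rule inj_onI, rule ccontr)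
    fix u u' assume u: "u \<in> nbrs E v \<inter> S" "u' \<in> nbrs E v \<inter> S" "cell v u = cell v u'" "u \<noteq> u'"
    then have "v \<in> nbrs E u" "v \<in> nbrs E u'" using nbrs_sym[of _ E v] by blast+
    then have "R u u'" using u by (auto simp: R_def)
    then show False using S(2)[of u u'] u by simp
  qed
  \<comment> \<open>A vertex of a good set loses nothing, one of low degree at most one of its at
    least \<open>k + 1\<close> neighbours, and one of degree \<open>d \<ge> 5 * k\<close> at most
    \<open>(d + 1) div 2\<close>.\<close>
  have bound: "k + card (nbrs E v \<inter> S) \<le> vertex_degree E v" if v: "v \<in> V" for v
  proof (cases "v \<in> \<Union>maxgood")
    case True
    have "nbrs E v \<inter> S = {}"
    proof (rule equals0I)
      fix u assume u: "u \<in> nbrs E v \<inter> S"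
      then have "u \<notin> \<Union>maxgood" "between E {u} (\<Union>maxgood) = 0" using S(1) by (auto simp: low_def)
      then have "card (nbrs E u \<inter> \<Union>maxgood) = 0" using between_eq_card_nbrs[OF graph] by metis
      then have "nbrs E u \<inter> \<Union>maxgood = {}" using finite_nbrs by simp
      moreover have "v \<in> nbrs E u" using u nbrs_sym[of u E v] by blast
      ultimately show False using True by blast
    qed
    then show ?thesis using degree_ge[OF v] by simp
  next
    case False
    then have d: "k + 1 \<le> vertex_degree E v" using degree_ge_Suc v by simp
    have c: "card (nbrs E v \<inter> S) = card (cell v ` (nbrs E v \<inter> S))"
      by (rule card_image[OF inj, symmetric])
    show ?thesis
    proof (cases "vertex_degree E v < 5 * k")
      case True
      have "card (cell v ` (nbrs E v \<inter> S)) \<le> card {0::nat}"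
        using True by (intro card_mono) (auto simp: cell_def)
      then show ?thesis using c d by simp
    next
      case False
      have "cell v ` (nbrs E v \<inter> S) \<subseteq> {0..<(vertex_degree E v + 1) div 2}"
      proof
        fix q assume "q \<in> cell v ` (nbrs E v \<inter> S)"
        then obtain u where "u \<in> nbrs E v" "q = g v u div 2" using False by (auto simp: cell_def)
        moreover from this have "g v u < vertex_degree E v" using g(2)[of v] by auto
        ultimately show "q \<in> {0..<(vertex_degree E v + 1) div 2}" by auto
      qed
      then have "card (cell v ` (nbrs E v \<inter> S)) \<le> card {0..<(vertex_degree E v + 1) div 2}"
        by (intro card_mono) auto
      then show ?thesis using c False k_ge by simp
    qed
  qed
  have "core E k (V - S)"
  proof (rule core_delete[OF graph])
    have "V \<noteq> {}" using card_V_ge k_ge by auto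
    then obtain v where v: "v \<in> V" by blast
    have "nbrs E v \<inter> S \<noteq> nbrs E v"
      using bound[OF v] k_ge vertex_degree_eq_card_nbrs[OF graph, of v] by auto
    then show "V - S \<noteq> {}" using nbrs_subset[OF graph, of v] by blast
  next
    fix v assume v: "v \<in> V - S"
    then show "k + between E {v} S \<le> vertex_degree E v"
      using bound[of v] between_eq_card_nbrs[OF graph, of v S] by simp
  qed
  then have small: "real (card S) < real (card V) / N" by (rule card_core_gt[OF SV])
  have "card V \<le> 2 * (card S * (25 * k\<^sup>2 + 1))" using card_low[OF asm] S(3) by linarith
  then have "real (card V) \<le> real (2 * (card S * (25 * k\<^sup>2 + 1)))" by (simp only: of_nat_le_iff)
  also have "\<dots> = real (card S) * (50 * (real k)\<^sup>2 + 2)" by (simp add: algebra_simps)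
  also have "\<dots> \<le> real (card S) * N"
  proof (intro mult_left_mono)
    have "1 \<le> (real k)\<^sup>2" using k_ge by simp
    then show "50 * (real k)\<^sup>2 + 2 \<le> N" using N_k by simp
  qed simp
  finally show False using small N_pos by (simp add: field_simps)
qed

subsection \<open>Many vertices in good sets\<close>

definition units :: "'a set set" where
  "units = maxgood \<union> (\<lambda>v. {v}) ` (V - \<Union>maxgood)"

lemma finite_units: "finite units"
  using finite_maxgood finite_V by (simp add: units_def)

lemma units_cases:
  assumes "u \<in> units"
  obtains "u \<in> maxgood" | v where "u = {v}" "v \<in> V - \<Union>maxgood"
  using assms by (auto simp: units_def)

lemma unit_subset: "u \<in> units \<Longrightarrow> u \<subseteq> V"
  by (elim units_cases) (auto dest: maxgood_subset)

lemma unit_ne: "u \<in> units \<Longrightarrow> u \<noteq> {}"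
  by (elim units_cases) (auto dest: maxgood_ne)

lemma units_disjoint:
  assumes "u \<in> units" "u' \<in> units" "u \<noteq> u'"
  shows "u \<inter> u' = {}"
  using assms(1)
proof (cases rule: units_cases)
  case 1
  show ?thesis using assms(2)
  proof (cases rule: units_cases)
    case 1
    then show ?thesis using \<open>u \<in> maxgood\<close> assms(3) by (intro maxgood_disjoint)
  qed (use 1 in blast)
next
  case (2 v)
  show ?thesis using assms(2)
    by (cases rule: units_cases) (use 2 assms(3) in blast)+
qed

lemma unit_card: "u \<in> units \<Longrightarrow> real (card u) \<le> real (card V) / N + 1"
  using N_pos by (elim units_cases) (auto dest: maxgood_card)

lemma unit_excess: "u \<in> units \<Longrightarrow> 1 \<le> exc u"
  by (elim units_cases) (auto simp: maxgood_excess excess_singleton dest: degree_ge)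

lemma between_units:
  assumes "u \<in> units" "\<X> \<subseteq> units" "u \<notin> \<X>"
  shows "between E u (\<Union>\<X>) = (\<Sum>x\<in>\<X>. between E u x)"
proof (rule between_Union[OF graph])
  show "finite \<X>" using assms(2) finite_units finite_subset by blast
  show "u \<inter> X = {}" if "X \<in> \<X>" for X
    using units_disjoint[of u X] assms that by blast
  show "X \<inter> Y = {}" if "X \<in> \<X>" "Y \<in> \<X>" "X \<noteq> Y" for X Y
    using units_disjoint[of X Y] assms(2) that by blast
qed

lemma between_le_degree: "between E {v} X \<le> vertex_degree E v"
  unfolding between_def vertex_degree_def using finite_E by (intro card_mono) auto

lemma unit_system_units:
  "unit_system units (between E) (\<lambda>u. nat (exc u)) (\<lambda>\<X>. exc (\<Union>\<X>)) maxgood k t"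
proof
  show "finite units" by (rule finite_units)
  show "between E u v = between E v u" for u v by (rule between_commute)
  show "1 \<le> nat (exc u)" if "u \<in> units" for u using unit_excess[OF that] by simp
  show "exc (\<Union>{}) = 0" by simp
  show "exc (\<Union>(insert u \<X>)) = exc (\<Union>\<X>) + int (nat (exc u)) - int (sum (between E u) \<X>)"
    if "u \<in> units" "\<X> \<subseteq> units" "u \<notin> \<X>" for u \<X>
  proof -
    have sub: "\<Union>\<X> \<subseteq> V" "u \<subseteq> V" using that unit_subset by blast+
    have "u \<inter> \<Union>\<X> = {}" using units_disjoint[OF that(1)] that by blast
    then show ?thesis
      using excess_Un[OF finite_E finite_sub[OF sub(2)] finite_sub[OF sub(1)], of k]
        between_units[OF that] unit_excess[OF that(1)] by simp
  qed
  show "- int t \<le> exc (\<Union>\<X>)" if "\<X> \<subseteq> units" for \<X>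
    using that unit_subset by (intro excess_lower) blast
  \<comment> \<open>Maximal good sets have excess 1, so \<open>u\<close> is a single vertex, whose
    degree is its excess plus \<open>k - 1\<close>.\<close>
  show "sum (between E u) \<X> \<le> nat (exc u) + k"
    if "u \<in> units" "\<X> \<subseteq> units - {u}" "nat (exc u) \<noteq> 1" for u \<X>
    using that(1)
  proof (cases rule: units_cases)
    case 1
    then show ?thesis using that(3) by (simp add: maxgood_excess)
  next
    case (2 v)
    have "\<X> \<subseteq> units" "u \<notin> \<X>" using that(2) by auto
    then have "sum (between E u) \<X> = between E {v} (\<Union>\<X>)"
      using between_units[OF that(1)] 2 by simp
    also have "\<dots> \<le> vertex_degree E v" by (rule between_le_degree)
    also have "\<dots> \<le> nat (exc u) + k" using 2 by (simp add: excess_singleton)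
    finally show ?thesis .
  qed
  show "maxgood \<subseteq> units" by (simp add: units_def)
  show "nat (exc C) = 1" if "C \<in> maxgood" for C using that by (simp add: maxgood_excess)
  show "between E u C < nat (exc u)" if "C \<in> maxgood" "u \<in> units" "u \<noteq> C" for C u
  proof -
    have "u \<inter> C = {}" using units_disjoint[of u C] that by (auto simp: units_def)
    then have "int (between E u C) < exc u"
      using that by (intro between_maxgood_less unit_subset unit_ne unit_card)
    then show ?thesis by linarith
  qed
  show "1 \<le> k" using k_ge by simp
qed

text \<open>Deleting a stable set of units that avoids \<open>s0\<close> leaves a core, so it covers
  fewer than \<open>card V / N\<close> vertices. By \<open>heavy_stable_set\<close> all good sets
  together are then small.\<close>

lemma card_maxgood_le: "4 * real (k + 1) * real (card (\<Union>maxgood)) \<le> real (card V)"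
proof (rule ccontr)
  assume A: "\<not> ?thesis"
  interpret unit_system units "between E" "\<lambda>u. nat (exc u)" "\<lambda>\<X>. exc (\<Union>\<X>)" maxgood k t
    by (rule unit_system_units)
  have "maxgood \<noteq> {}" using A by auto
  then obtain s0 where s0: "s0 \<in> maxgood" by blast
  define M where "M = nat \<lfloor>real (card V) / N\<rfloor>"
  have M: "card C \<le> M" if "C \<in> maxgood" for C
    using maxgood_card[OF that] unfolding M_def by linarith
  have MN: "real M \<le> real (card V) / N" using N_pos by (simp add: M_def)
  obtain Z where Z: "stable Z" "s0 \<notin> Z"
    and w: "3 * sum card (maxgood - {s0}) \<le> 64 * k * sum card Z + (t + 1) * M"
    using heavy_stable_set[of s0 card M] s0 M by blast
  have ZU: "Z \<subseteq> units" using Z by (simp add: stable_def)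
  have cZ: "card (\<Union>Z) = sum card Z"
    using ZU units_disjoint unit_subset finite_sub
    by (intro card_Union_disjoint) (auto simp: pairwise_def disjnt_def subset_iff)
  have cA: "card (\<Union>maxgood) = sum card maxgood"
    using maxgood_disjoint maxgood_finite
    by (intro card_Union_disjoint) (auto simp: pairwise_def disjnt_def)
  have "core E k (V - \<Union>Z)"
  proof (rule core_delete[OF graph])
    have "s0 \<in> units" using s0 by (simp add: units_def)
    then have "s0 \<inter> \<Union>Z = {}" using units_disjoint[of s0] Z(2) ZU by blast
    then show "V - \<Union>Z \<noteq> {}" using maxgood_ne[OF s0] maxgood_subset[OF s0] by blast
  next
    fix v assume v: "v \<in> V - \<Union>Z"
    \<comment> \<open>For a good set stability means no edge to \<open>Z\<close> at all; for a
      single vertex, the strict inequality against the degree minus \<open>k - 1\<close> leaves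
      \<open>k\<close> neighbours.\<close>
    show "k + between E {v} (\<Union>Z) \<le> vertex_degree E v"
    proof (cases "v \<in> \<Union>maxgood")
      case True
      then obtain C where C: "C \<in> maxgood" "v \<in> C" by blast
      have CU: "C \<in> units - Z" using C v by (auto simp: units_def)
      then have "sum (between E C) Z < nat (exc C)" using Z(1) by (simp add: stable_def)
      then have "between E C (\<Union>Z) = 0"
        using between_units[of C Z] CU ZU C by (simp add: maxgood_excess)
      then have "between E {v} (\<Union>Z) = 0"
        using between_mono[OF finite_E, of "{v}" C "\<Union>Z"] C by simp
      then show ?thesis using degree_ge v by simp
    next
      case False
      then have vU: "{v} \<in> units - Z" using v by (auto simp: units_def)
      then have "sum (between E {v}) Z < nat (exc {v})" using Z(1) by (simp add: stable_def)
      then have "between E {v} (\<Union>Z) < nat (exc {v})" using between_units[of "{v}" Z] vU ZU by simp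
      then show ?thesis by (simp add: excess_singleton)
    qed
  qed
  moreover have "\<Union>Z \<subseteq> V" using ZU unit_subset by blast
  ultimately have small: "real (sum card Z) < real (card V) / N"
    using card_core_gt[of "\<Union>Z"] cZ by simp
  define x where "x = real (card V) / N"
  have x0: "0 \<le> x" using N_pos by (simp add: x_def)
  have nx: "real (card V) = N * x" using N_pos by (simp add: x_def)
  have "3 * real (sum card (maxgood - {s0})) \<le> 64 * real k * real (sum card Z) + (real t + 1) * real M"
  proof -
    have "real (3 * sum card (maxgood - {s0})) \<le> real (64 * k * sum card Z + (t + 1) * M)"
      using w by (simp only: of_nat_le_iff)
    then show ?thesis by (simp add: distrib_right)
  qed
  also have "\<dots> \<le> 64 * real k * x + (real t + 1) * x"
    using small MN by (intro add_mono mult_left_mono) (auto simp: x_def)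
  finally have 1: "3 * real (sum card (maxgood - {s0})) \<le> 64 * real k * x + (real t + 1) * x" .
  have "sum card maxgood = card s0 + sum card (maxgood - {s0})"
    using finite_maxgood s0 by (rule sum.remove)
  then have "real (card (\<Union>maxgood)) \<le> x + real (sum card (maxgood - {s0}))"
    using maxgood_card[OF s0] by (simp add: cA x_def)
  then have "3 * real (card (\<Union>maxgood)) \<le> (64 * real k + real t + 4) * x"
    using 1 by (simp add: algebra_simps)
  then have "4 * real (k + 1) * (3 * real (card (\<Union>maxgood))) \<le> 4 * real (k + 1) * ((64 * real k + real t + 4) * x)"
    by (intro mult_left_mono) auto
  \<comment> \<open>The two lower bounds on \<open>N\<close> absorb the terms in
    \<open>k * k\<close> and \<open>k * t\<close>; the fraction \<open>16 / 3\<close> comes from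
    \<open>k \<ge> 3\<close>.\<close>
  moreover have "4 * real (k + 1) * (64 * real k + real t + 4) \<le> 3 * N"
  proof -
    have "4 * real (k + 1) \<le> 16 / 3 * real k" "64 * real k + real t + 4 \<le> 66 * real k + real t" using k_ge by auto
    then have "4 * real (k + 1) * (64 * real k + real t + 4) \<le> 16 / 3 * real k * (66 * real k + real t)"
      by (rule mult_mono) simp_all
    also have "\<dots> = 352 * (real k)\<^sup>2 + 16 / 3 * (real k * real t)" by (simp add: power2_eq_square algebra_simps)
    also have "\<dots> \<le> 3 * N"
    proof -
      have "0 \<le> real k * real t" "0 \<le> (real k)\<^sup>2" by auto
      moreover have "10000 * (real k)\<^sup>2 \<le> N" "100 * (real k * real t) \<le> N"
        using N_k N_t by (simp_all add: mult.assoc)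
      ultimately show ?thesis by linarith
    qed
    finally show ?thesis .
  qed
  then have "4 * real (k + 1) * (64 * real k + real t + 4) * x \<le> 3 * N * x"
    using x0 by (rule mult_right_mono)
  ultimately show False using A nx by (simp add: algebra_simps)
qed

end

section \<open>Induction\<close>

text \<open>The induction counts vertices plus edges, so that either a surplus edge or a set of
  excess at most 0 can be removed, while \<open>N\<close> stays fixed.\<close>

lemma small_core_exists:
  fixes E :: "'a set set" and N :: real
  assumes "simple_graph V E"
    and k: "3 \<le> k" and t: "1 \<le> t" "2 * int t + 2 \<le> (int k - 2) * (int k + 1)"
    and "(int k - 1) * int (card V) - int t \<le> int (card E)" and "k - 1 \<le> card V"
    and N: "10 ^ 4 * (real k)\<^sup>2 \<le> N" "100 * real k * real t \<le> N"
  shows "\<exists>W\<subseteq>V. core E k W \<and> real (card W) \<le> (1 - 1 / N) * real (card V)"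
  using assms(1,5,6)
proof (induction "card V + card E" arbitrary: V E rule: less_induct)
  case less
  note G = less.prems(1)
  have fin: "finite V" "finite E" using simple_graph_finite[OF G] by auto
  have "(1::real) \<le> 10 ^ 4 * (real k)\<^sup>2"
    using mult_mono[of 1 "10 ^ 4::real" 1 "(real k)\<^sup>2"] k by simp
  then have N1: "1 \<le> N" using N by linarith
  show ?case
  proof (rule ccontr)
    assume neg: "\<not> ?case"
    have tight: "int (card E) = (int k - 1) * int (card V) - int t"
    proof (rule ccontr)
      assume "\<not> ?thesis"
      then have gt: "(int k - 1) * int (card V) - int t < int (card E)" using less.prems(2) by simp
      \<comment> \<open>A graph with surplus therefore has an edge to remove.\<close>
      have "int t \<le> (int k - 1) * int (card V)" if "card V \<ge> k - 1"
      proof -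
        have "(int k - 1) * (int k - 1) \<le> (int k - 1) * int (card V)"
          using that k by (intro mult_left_mono) auto
        moreover have "3 * int k \<le> int k * int k" using k by (intro mult_right_mono) auto
        ultimately show ?thesis using t(2) by (simp add: algebra_simps)
      qed
      then have "0 < int (card E)" using gt less.prems(3) by linarith
      then obtain e where e: "e \<in> E" by fastforce
      have c: "card E = card (E - {e}) + 1" using card.remove[OF fin(2) e] by simp
      have "simple_graph V (E - {e})" using G by (auto simp: simple_graph_def)
      then obtain W where "W \<subseteq> V" "core (E - {e}) k W" "real (card W) \<le> (1 - 1 / N) * real (card V)"
        using less.hyps[of V "E - {e}"] c gt less.prems(3) by auto
      moreover have "core E k W" by (rule core_mono[OF calculation(2) _ fin(2)]) auto
      ultimately show False using neg by blast
    qed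
    have pos: "1 \<le> excess E k X" if X: "X \<subseteq> V" "X \<noteq> {}" "card X + (k - 1) \<le> card V" for X
    proof (rule ccontr)
      assume "\<not> ?thesis"
      then have le: "excess E k X \<le> 0" by simp
      let ?E = "{e \<in> E. e \<subseteq> V - X}"
      have cX: "card X \<le> card V" "0 < card X"
        using X fin by (auto simp: card_mono card_gt_0_iff finite_subset)
      have cV: "card (V - X) = card V - card X" using X fin by (simp add: card_Diff_subset finite_subset)
      have iV: "int (card (V - X)) = int (card V) - int (card X)" using cV cX by simp
      have "int (card ?E) + int (card {e \<in> E. e \<inter> X \<noteq> {}}) = int (card E)"
        using card_edges_delete[OF G, of X] by linarith
      then have "(int k - 1) * int (card (V - X)) - int t \<le> int (card ?E)"
        using le less.prems(2) unfolding excess_def iV by (simp add: algebra_simps)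
      moreover have "card ?E \<le> card E" using fin by (intro card_mono) auto
      then have "card (V - X) + card ?E < card V + card E" using cV cX by linarith
      moreover have "k - 1 \<le> card (V - X)" using cV X by linarith
      ultimately obtain W where W: "W \<subseteq> V - X" "core ?E k W"
        and cW: "real (card W) \<le> (1 - 1 / N) * real (card (V - X))"
        using less.hyps[OF _ simple_graph_delete[OF G]] by blast
      have "core E k W" by (rule core_mono[OF W(2) _ fin(2)]) auto
      moreover have "(1 - 1 / N) * real (card (V - X)) \<le> (1 - 1 / N) * real (card V)"
        using N1 cV by (intro mult_left_mono) auto
      ultimately show False using neg W(1) cW by force
    qed
    interpret tight_graph V E k t N
      using G k t tight less.prems(3) N pos neg by unfold_locales auto
    show False using many_maxgood card_maxgood_le by blast
  qed
qed

theorem theorem1p3: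
  fixes k t n :: nat and V :: "'a set" and E :: "'a set set"
  assumes "k \<ge> 2"
    and "1 \<le> t"
    and "real t \<le> (real k - 2) * (real k + 1) / 2 - 1"
    and "simple_graph V E"
    and "card V = n"
    and "real n \<ge> real k - 1"
    and "real (card E) \<ge> (real k - 1) * real n - real t"
  shows "\<exists>W F. graph_subgraph W F V E
           \<and> real (card W) \<le> (1 - 1 / max (10 ^ 4 * (real k)\<^sup>2) (100 * real k * real t)) * real n
           \<and> graph_min_degree W F \<ge> k"
proof -
  \<comment> \<open>For \<open>k = 2\<close> the upper bound on \<open>t\<close> is
    \<open>- 1\<close>.\<close>
  have k: "3 \<le> k"
  proof (rule ccontr)
    assume "\<not> 3 \<le> k"
    then have "k = 2" using assms(1) by simp
    then show False using assms(2,3) by simp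
  qed
  have "real_of_int (2 * int t + 2) \<le> real_of_int ((int k - 2) * (int k + 1))"
    using assms(3) by simp
  then have t: "2 * int t + 2 \<le> (int k - 2) * (int k + 1)" by (simp only: of_int_le_iff)
  have "real_of_int ((int k - 1) * int (card V) - int t) \<le> real_of_int (int (card E))"
    using assms(5,7) by simp
  then have E: "(int k - 1) * int (card V) - int t \<le> int (card E)" by (simp only: of_int_le_iff)
  have "k - 1 \<le> card V" using assms(5,6) by linarith
  then obtain W where W: "W \<subseteq> V" "core E k W"
    and cW: "real (card W) \<le> (1 - 1 / max (10 ^ 4 * (real k)\<^sup>2) (100 * real k * real t)) * real (card V)"
    using small_core_exists[OF assms(4) k assms(2) t E _ max.cobounded1 max.cobounded2] by blast
  let ?F = "{e \<in> E. e \<subseteq> W}"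
  have finW: "finite W" using W(1) simple_graph_finite[OF assms(4)] finite_subset by blast
  have "graph_subgraph W ?F V E"
    using W assms(4) finW by (auto simp: graph_subgraph_def simple_graph_def core_def)
  moreover have "k \<le> graph_min_degree W ?F"
    unfolding graph_min_degree_def using W(2) finW by (subst Min_ge_iff) (auto simp: core_def)
  ultimately show ?thesis using cW assms(5) by blast
qed

end
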